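(* For any finite-dimensional multipartite quantum system $\mathcal{H}=\mathcal{H}_1\otimes\cdots\otimes\mathcal{H}_n$ with $n>1$, $d_i=\dim_{\mathbb{C}}\mathcal{H}_i>1$ for all $i$, and $d=\prod_{i=1}^n d_i$, the following inequalities hold: $$d \le L_c \le L_{\rm crit} \le L_{\rm max} \le d^2.$$
   Context: Let $H$ be the real vector space (of dimension $d^2$) of Hermitian operators on $\mathcal{H}$, and $H_1\subset H$ the affine hyperplane of operators of trace $1$. A product vector is a nonzero vector of the form $|x_1\rangle\otimes\cdots\otimes|x_n\rangle$ with $|x_i\rangle\in\mathcal{H}_i$. A (non-normalized) state is a nonzero positive semidefinite operator on $\mathcal{H}$. It is separable if it can be written as $\rho=\sum_{k=1}^{l}|z_k\rangle\langle z_k|$ with all $|z_k\rangle$ product vectors; the length $L(\rho)$ is the smallest $l$ over all such decompositions. $\mathcal{S}\subset H_1$ denotes the set of separable states of trace $1$, and for a positive integer $r$, $\mathcal{S}'_r=\{\rho\in\mathcal{S}: L(\rho)\le r\}$. The sets $\mathcal{S}'_r$ are semialgebraic subsets of $H_1$, and $\dim$ of such a set denotes real dimension as a semialgebraic set. The maximum length $L_{\rm max}$ is the smallest positive integer $r$ such that $\mathcal{S}'_r=\mathcal{S}$. The critical length $L_{\rm crit}$ is the smallest positive integer $r$ such that $\dim\mathcal{S}'_r=d^2-1$ (equivalently, such that $\mathcal{S}'_r$ has positive volume in $H_1$). The integer $L_c$ is defined by $L_c=\left\lceil \dfrac{d^2}{1+2\sum_{i=1}^n(d_i-1)}\right\rceil$.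 *)

theory Defs
  imports "HOL-Analysis.Analysis"
begin

section \<open>Vectors and operators over a finite index set\<close>

text \<open>The Hilbert space with orthonormal basis indexed by the finite set \<open>I\<close> is the set of
  complex functions supported on \<open>I\<close>; operators are given by their matrices in this basis.\<close>

definition coord_space :: "'i set \<Rightarrow> ('i \<Rightarrow> complex) set" where
  "coord_space I = {v. \<forall>i. i \<notin> I \<longrightarrow> v i = 0}"

definition operators :: "'i set \<Rightarrow> ('i \<Rightarrow> 'i \<Rightarrow> complex) set" where
  "operators I = {A. \<forall>i j. i \<notin> I \<or> j \<notin> I \<longrightarrow> A i j = 0}"

definition hermitian_operators :: "'i set \<Rightarrow> ('i \<Rightarrow> 'i \<Rightarrow> complex) set" where
  "hermitian_operators I = {A \<in> operators I. \<forall>i j. A j i = cnj (A i j)}"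

definition op_apply :: "'i set \<Rightarrow> ('i \<Rightarrow> 'i \<Rightarrow> complex) \<Rightarrow> ('i \<Rightarrow> complex) \<Rightarrow> 'i \<Rightarrow> complex" where
  "op_apply I A v = (\<lambda>i. \<Sum>j\<in>I. A i j * v j)"

definition hinner :: "'i set \<Rightarrow> ('i \<Rightarrow> complex) \<Rightarrow> ('i \<Rightarrow> complex) \<Rightarrow> complex" where
  "hinner I v w = (\<Sum>i\<in>I. cnj (v i) * w i)"

definition op_trace :: "'i set \<Rightarrow> ('i \<Rightarrow> 'i \<Rightarrow> complex) \<Rightarrow> complex" where
  "op_trace I A = (\<Sum>i\<in>I. A i i)"

text \<open>For Hermitian \<open>A\<close> the number \<open>hinner I v (op_apply I A v)\<close> is real.\<close>

definition positive_semidefinite :: "'i set \<Rightarrow> ('i \<Rightarrow> 'i \<Rightarrow> complex) \<Rightarrow> bool" where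
  "positive_semidefinite I A \<longleftrightarrow> A \<in> hermitian_operators I \<and>
     (\<forall>v\<in>coord_space I. 0 \<le> Re (hinner I v (op_apply I A v)))"

definition is_state :: "'i set \<Rightarrow> ('i \<Rightarrow> 'i \<Rightarrow> complex) \<Rightarrow> bool" where
  "is_state I A \<longleftrightarrow> positive_semidefinite I A \<and> A \<noteq> (\<lambda>_ _. 0)"

definition ketbra :: "('i \<Rightarrow> complex) \<Rightarrow> 'i \<Rightarrow> 'i \<Rightarrow> complex" where
  "ketbra z = (\<lambda>i j. z i * cnj (z j))"

section \<open>Semialgebraic sets and their dimension\<close>

text \<open>The space \<open>\<real>\<^sup>J\<close> for a finite index set \<open>J\<close>, as the functions supported on \<open>J\<close>. The topology
  used below is the product topology of the function type, which induces the Euclidean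
  topology on this space.\<close>

definition real_space :: "'j set \<Rightarrow> ('j \<Rightarrow> real) set" where
  "real_space J = {x. \<forall>j. j \<notin> J \<longrightarrow> x j = 0}"

inductive_set poly_functions :: "'j set \<Rightarrow> (('j \<Rightarrow> real) \<Rightarrow> real) set" for J where
  const: "(\<lambda>_. c) \<in> poly_functions J"
| coord: "j \<in> J \<Longrightarrow> (\<lambda>x. x j) \<in> poly_functions J"
| add: "p \<in> poly_functions J \<Longrightarrow> q \<in> poly_functions J \<Longrightarrow> (\<lambda>x. p x + q x) \<in> poly_functions J"
| mult: "p \<in> poly_functions J \<Longrightarrow> q \<in> poly_functions J \<Longrightarrow> (\<lambda>x. p x * q x) \<in> poly_functions J"

text \<open>The Boolean algebra of subsets of \<open>\<real>\<^sup>J\<close> generated by the sets \<open>{p > 0}\<close>, \<open>p\<close> polynomial.\<close>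

inductive semialgebraic :: "'j set \<Rightarrow> ('j \<Rightarrow> real) set \<Rightarrow> bool" for J where
  pos: "p \<in> poly_functions J \<Longrightarrow> semialgebraic J {x \<in> real_space J. p x > 0}"
| compl: "semialgebraic J A \<Longrightarrow> semialgebraic J (real_space J - A)"
| inter: "semialgebraic J A \<Longrightarrow> semialgebraic J B \<Longrightarrow> semialgebraic J (A \<inter> B)"

text \<open>A map is semialgebraic if its graph is, where \<open>\<real>\<^sup>J \<times> \<real>\<^sup>K\<close> is identified with the space
  over the disjoint sum of the index sets.\<close>

definition semialgebraic_map ::
    "'j set \<Rightarrow> 'k set \<Rightarrow> ('j \<Rightarrow> real) set \<Rightarrow> (('j \<Rightarrow> real) \<Rightarrow> ('k \<Rightarrow> real)) \<Rightarrow> bool" where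
  "semialgebraic_map J K A f \<longleftrightarrow>
     A \<subseteq> real_space J \<and> f ` A \<subseteq> real_space K \<and>
     semialgebraic (J <+> K) ((\<lambda>x. case_sum x (f x)) ` A)"

definition open_cube :: "nat \<Rightarrow> (nat \<Rightarrow> real) set" where
  "open_cube k = {x \<in> real_space {..<k}. \<forall>i<k. 0 < x i \<and> x i < 1}"

text \<open>The set \<open>C\<close> is semialgebraically homeomorphic to the open cube \<open>(0,1)\<^sup>k\<close>. (The graph of
  the inverse is the transposed graph, so only one direction needs to be required semialgebraic.)\<close>

definition semialgebraic_cell :: "'j set \<Rightarrow> nat \<Rightarrow> ('j \<Rightarrow> real) set \<Rightarrow> bool" where
  "semialgebraic_cell J k C \<longleftrightarrow>
     (\<exists>f g. homeomorphism (open_cube k) C f g \<and> semialgebraic_map {..<k} J (open_cube k) f)"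

text \<open>A semialgebraic set is a finite disjoint union of cells, and its dimension is the largest
  dimension of a cell in such a decomposition; this is the largest dimension of any cell
  contained in the set.\<close>

definition semialgebraic_dim :: "'j set \<Rightarrow> ('j \<Rightarrow> real) set \<Rightarrow> int" where
  "semialgebraic_dim J A =
     (if A = {} then -1 else int (Max {k. \<exists>C\<subseteq>A. semialgebraic_cell J k C}))"

text \<open>Real coordinates of operators: an injective real-linear map from the operators over \<open>I\<close>
  into the real space over \<open>I \<times> I \<times> UNIV\<close>. Dimension is invariant under such maps.\<close>

definition real_coords :: "('i \<Rightarrow> 'i \<Rightarrow> complex) \<Rightarrow> 'i \<times> 'i \<times> bool \<Rightarrow> real" where
  "real_coords A = (\<lambda>(i, j, b). if b then Im (A i j) else Re (A i j))"

definition operator_set_dim :: "'i set \<Rightarrow> ('i \<Rightarrow> 'i \<Rightarrow> complex) set \<Rightarrow> int" where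
  "operator_set_dim I X = semialgebraic_dim (I \<times> I \<times> UNIV) (real_coords ` X)"

section \<open>Multipartite systems and separable states\<close>

text \<open>In a system with \<open>n\<close> parties of dimensions \<open>d 0, \<dots>, d (n - 1)\<close>, the party \<open>i\<close> has the space
  \<open>coord_space {..<d i}\<close>, and the tensor product has the product basis, indexed by multi-indices.\<close>

definition multi_indices :: "nat \<Rightarrow> (nat \<Rightarrow> nat) \<Rightarrow> (nat \<Rightarrow> nat) set" where
  "multi_indices n d = (\<Pi>\<^sub>E i\<in>{..<n}. {..<d i})"

definition tensor_vec ::
    "nat \<Rightarrow> (nat \<Rightarrow> nat) \<Rightarrow> (nat \<Rightarrow> nat \<Rightarrow> complex) \<Rightarrow> (nat \<Rightarrow> nat) \<Rightarrow> complex" where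
  "tensor_vec n d x = (\<lambda>a. if a \<in> multi_indices n d then \<Prod>i<n. x i (a i) else 0)"

definition product_vector :: "nat \<Rightarrow> (nat \<Rightarrow> nat) \<Rightarrow> ((nat \<Rightarrow> nat) \<Rightarrow> complex) \<Rightarrow> bool" where
  "product_vector n d z \<longleftrightarrow> z \<noteq> (\<lambda>_. 0) \<and>
     (\<exists>x. (\<forall>i<n. x i \<in> coord_space {..<d i}) \<and> z = tensor_vec n d x)"

type_synonym multi_operator = "(nat \<Rightarrow> nat) \<Rightarrow> (nat \<Rightarrow> nat) \<Rightarrow> complex"

definition product_decomposition ::
    "nat \<Rightarrow> (nat \<Rightarrow> nat) \<Rightarrow> multi_operator \<Rightarrow> nat \<Rightarrow> (nat \<Rightarrow> (nat \<Rightarrow> nat) \<Rightarrow> complex) \<Rightarrow> bool" where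
  "product_decomposition n d \<rho> l z \<longleftrightarrow>
     (\<forall>k<l. product_vector n d (z k)) \<and> \<rho> = (\<lambda>a b. \<Sum>k<l. ketbra (z k) a b)"

definition separable_state :: "nat \<Rightarrow> (nat \<Rightarrow> nat) \<Rightarrow> multi_operator \<Rightarrow> bool" where
  "separable_state n d \<rho> \<longleftrightarrow>
     is_state (multi_indices n d) \<rho> \<and> (\<exists>l z. product_decomposition n d \<rho> l z)"

definition state_length :: "nat \<Rightarrow> (nat \<Rightarrow> nat) \<Rightarrow> multi_operator \<Rightarrow> nat" where
  "state_length n d \<rho> = (LEAST l. \<exists>z. product_decomposition n d \<rho> l z)"

definition trace_one_hyperplane :: "nat \<Rightarrow> (nat \<Rightarrow> nat) \<Rightarrow> multi_operator set" where
  "trace_one_hyperplane n d =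
     {A \<in> hermitian_operators (multi_indices n d). op_trace (multi_indices n d) A = 1}"

definition sep_states :: "nat \<Rightarrow> (nat \<Rightarrow> nat) \<Rightarrow> multi_operator set" where
  "sep_states n d = {\<rho> \<in> trace_one_hyperplane n d. separable_state n d \<rho>}"

definition sep_states_le :: "nat \<Rightarrow> (nat \<Rightarrow> nat) \<Rightarrow> nat \<Rightarrow> multi_operator set" where
  "sep_states_le n d r = {\<rho> \<in> sep_states n d. state_length n d \<rho> \<le> r}"

definition total_dim :: "nat \<Rightarrow> (nat \<Rightarrow> nat) \<Rightarrow> nat" where
  "total_dim n d = (\<Prod>i<n. d i)"

definition L_max :: "nat \<Rightarrow> (nat \<Rightarrow> nat) \<Rightarrow> nat" where
  "L_max n d = (LEAST r. 0 < r \<and> sep_states_le n d r = sep_states n d)"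

definition L_crit :: "nat \<Rightarrow> (nat \<Rightarrow> nat) \<Rightarrow> nat" where
  "L_crit n d = (LEAST r. 0 < r \<and>
     operator_set_dim (multi_indices n d) (sep_states_le n d r) = int ((total_dim n d)\<^sup>2) - 1)"

definition L_c :: "nat \<Rightarrow> (nat \<Rightarrow> nat) \<Rightarrow> nat" where
  "L_c n d = nat \<lceil>real ((total_dim n d)\<^sup>2) / (1 + 2 * (\<Sum>i<n. (real (d i) - 1)))\<rceil>"

end

theory Submission
  imports Defs "HOL-Homology.Invariance_of_Domain"
begin

text \<open>A product projector, up to a positive factor, has \<open>2 * (\<Sum>i<n. d i - 1)\<close> real parameters, so the
  cone over the states of length at most \<open>r\<close> is covered by finitely many polynomial images of cubes of
  dimension \<open>r * (1 + 2 * (\<Sum>i<n. d i - 1))\<close>. If these states contain a cell of dimension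
  \<open>(total_dim n d)\<^sup>2 - 1\<close>, then by invariance of domain the cell is open in the hyperplane, so the cone
  contains a box in the space of Hermitian operators; counting grid points in this box bounds
  \<open>r\<close> from below. Conversely, the separable states contain the simplex spanned by a basis of
  product projectors, and by Caratheodory's argument every separable state is a sum of
  \<open>(total_dim n d)\<^sup>2\<close> product projectors.\<close>

text \<open>Passing to the cone frees the scale: the \<open>r\<close> weights and the entries of the
  vectors vary independently, without a trace condition coupling them, and their number can be
  compared with the full real dimension \<open>(total_dim n d)\<^sup>2\<close> of the Hermitian
  operators. Scaling by a factor in (0,1] keeps all these parameters bounded, so polynomial maps are
  Lipschitz on their range. A cell is only a homeomorphic image of a cube, so that a cell of top
  dimension is open is a topological fact and not a matter of the rank of a derivative. The same
  fact bounds the dimensions of all cells in the hyperplane, so the maximum defining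
  \<open>semialgebraic_dim\<close> is taken over a finite set. The counting argument expresses that
  a Lipschitz map cannot raise dimension.\<close>

section \<open>The integer \<open>L_c\<close>\<close>

text \<open>This is where at least two parties matter: a single factor of dimension above 2 violates
  the bound. A further factor \<open>Suc e\<close> adds \<open>2 * e\<close> on the left and
  \<open>D * e\<close> on the right, and \<open>2 \<le> D\<close>.\<close>

lemma twice_sum_pred_le_prod:
  fixes d :: "nat \<Rightarrow> nat"
  assumes "2 \<le> n" "\<And>i. i < n \<Longrightarrow> 1 < d i"
  shows "2 * (\<Sum>i<n. d i - 1) \<le> (\<Prod>i<n. d i)"
  using assms
proof (induction n rule: nat_induct_at_least)
  case base
  have "1 < d 0" "1 < d 1"
    using base by auto
  then have ab: "d 0 = (d 0 - 2) + 2" "d 1 = (d 1 - 2) + 2"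
    by auto
  \<comment> \<open>For two factors the claim amounts to
    \<open>(d 0 - 2) * (d 1 - 2) \<ge> 0\<close>; the shift turns it into a statement free of
    truncated subtraction.\<close>
  define a b where "a = d 0 - 2" and "b = d 1 - 2"
  have "d 0 = Suc (Suc a)" "d (Suc 0) = Suc (Suc b)"
    using ab by (simp_all add: a_def b_def)
  then show ?case
    by (simp add: numeral_2_eq_2)
next
  case (Suc n)
  define D where "D = (\<Prod>i<n. d i)"
  obtain e where e: "d n = Suc e"
    using Suc.prems[of n] by (cases "d n") auto
  have IH: "2 * (\<Sum>i<n. d i - 1) \<le> D"
    using Suc D_def by simp
  have D: "D > 0"
    unfolding D_def using Suc.prems by (intro prod_pos) (meson lessThan_iff less_SucI less_trans zero_less_one)
  have "2 \<le> D"
  proof -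
    have "1 < d 0" using Suc.prems[of 0] by simp
    moreover have "0 < n" using Suc.hyps by simp
    ultimately have "(\<Sum>i<n. d i - 1) \<ge> d 0 - 1"
      by (intro member_le_sum) auto
    with \<open>1 < d 0\<close> IH show ?thesis by linarith
  qed
  then have "2 * e \<le> D * e" by simp
  moreover define S where "S = (\<Sum>i<n. d i - 1)"
  moreover have "2 * (S + e) = 2 * S + 2 * e" "D * Suc e = D + D * e"
    by simp_all
  ultimately have "2 * (S + e) \<le> D * Suc e"
    using IH by linarith
  then show ?case
    by (simp add: e D_def S_def)
qed

text \<open>The real dimension of the set of positive multiples of product projectors: a product of
  complex projective spaces of dimensions \<open>d i - 1\<close>, plus one for the weight.\<close>

definition product_params :: "nat \<Rightarrow> (nat \<Rightarrow> nat) \<Rightarrow> nat" where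
  "product_params n d = 1 + 2 * (\<Sum>i<n. d i - 1)"

lemma real_product_params:
  assumes "\<And>i. i < n \<Longrightarrow> 1 < d i"
  shows "real (product_params n d) = 1 + 2 * (\<Sum>i<n. (real (d i) - 1))"
  using assms by (simp add: product_params_def of_nat_diff less_imp_le)

lemma L_c_eq:
  assumes "\<And>i. i < n \<Longrightarrow> 1 < d i"
  shows "L_c n d = nat \<lceil>real ((total_dim n d)\<^sup>2) / real (product_params n d)\<rceil>"
  unfolding L_c_def by (simp only: real_product_params[of n d, OF assms])

lemma L_c_le:
  assumes "\<And>i. i < n \<Longrightarrow> 1 < d i" "(total_dim n d)\<^sup>2 \<le> r * product_params n d"
  shows "L_c n d \<le> r"
proof -
  have "real (product_params n d) > 0"
    unfolding product_params_def by linarith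
  moreover have "real ((total_dim n d)\<^sup>2) \<le> real r * real (product_params n d)"
    using assms(2) by (metis of_nat_le_iff of_nat_mult)
  ultimately have "real ((total_dim n d)\<^sup>2) / real (product_params n d) \<le> of_int (int r)"
    by (simp add: divide_le_eq)
  then have "\<lceil>real ((total_dim n d)\<^sup>2) / real (product_params n d)\<rceil> \<le> int r"
    by (rule ceiling_le)
  then show ?thesis
    by (simp only: L_c_eq[of n d, OF assms(1)] nat_le_iff)
qed

text \<open>With \<open>M \<le> D + 1\<close> for the denominator,
  \<open>(D - 1) * M \<le> D\<^sup>2 - 1 < D\<^sup>2\<close>. So the quotient exceeds
  \<open>D - 1\<close>, and its ceiling is at least \<open>D\<close>.\<close>

lemma total_dim_le_L_c:
  assumes "1 < n" "\<And>i. i < n \<Longrightarrow> 1 < d i"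
  shows "total_dim n d \<le> L_c n d"
proof -
  define D where "D = total_dim n d"
  define M where "M = product_params n d"
  have M: "0 < M" "M \<le> D + 1"
    using twice_sum_pred_le_prod[of n d] assms by (auto simp: M_def D_def product_params_def total_dim_def)
  have "(real D - 1) * real M \<le> (real D - 1) * (real D + 1)" if "D \<ge> 1"
    using M that by (intro mult_left_mono) auto
  also have "\<dots> = real (D\<^sup>2) - 1"
    by (simp add: power2_eq_square algebra_simps)
  finally have "(real D - 1) * real M < real (D\<^sup>2)" if "D \<ge> 1"
    using that by simp
  then have "of_int (int D - 1) < real (D\<^sup>2) / real M" if "D \<ge> 1"
    using that M by (simp add: less_divide_eq)
  then have "int D - 1 < \<lceil>real (D\<^sup>2) / real M\<rceil>" if "D \<ge> 1"
    using that less_ceiling_iff by blast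
  then have "D \<le> nat \<lceil>real (D\<^sup>2) / real M\<rceil>"
    by (cases "D \<ge> 1") linarith+
  then show ?thesis
    by (simp only: L_c_eq[of n d, OF assms(2)] D_def M_def)
qed

section \<open>Polynomial images of cubes\<close>

lemma poly_functions_sum:
  assumes "\<And>i. i \<in> A \<Longrightarrow> f i \<in> poly_functions J"
  shows "(\<lambda>x. \<Sum>i\<in>A. f i x) \<in> poly_functions J"
  using assms
  by (induction A rule: infinite_finite_induct) (auto intro: poly_functions.intros)

lemma poly_functions_minus:
  assumes "p \<in> poly_functions J"
  shows "(\<lambda>x. - p x) \<in> poly_functions J"
  using poly_functions.mult[OF poly_functions.const[of "-1"] assms] by simp

lemma poly_functions_diff:
  assumes "p \<in> poly_functions J" "q \<in> poly_functions J"
  shows "(\<lambda>x. p x - q x) \<in> poly_functions J"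
  using poly_functions.add[OF assms(1) poly_functions_minus[OF assms(2)]] by simp

text \<open>On the cube [-1,1]^P with the sup distance, expressed through the coordinates in
  \<open>P\<close> alone. One constant bounds both the size and the slope, since the product rule
  needs the sizes of the factors.\<close>

definition lipschitz_bound :: "'p set \<Rightarrow> (('p \<Rightarrow> real) \<Rightarrow> real) \<Rightarrow> real \<Rightarrow> bool" where
  "lipschitz_bound P f B \<longleftrightarrow> 0 \<le> B \<and> (\<forall>x. (\<forall>p\<in>P. \<bar>x p\<bar> \<le> 1) \<longrightarrow> \<bar>f x\<bar> \<le> B) \<and>
    (\<forall>x y \<delta>. (\<forall>p\<in>P. \<bar>x p\<bar> \<le> 1) \<longrightarrow> (\<forall>p\<in>P. \<bar>y p\<bar> \<le> 1) \<longrightarrow> 0 \<le> \<delta> \<longrightarrow>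
      (\<forall>p\<in>P. \<bar>x p - y p\<bar> \<le> \<delta>) \<longrightarrow> \<bar>f x - f y\<bar> \<le> B * \<delta>)"

lemma lipschitz_boundI:
  assumes "0 \<le> B" "\<And>x. \<forall>p\<in>P. \<bar>x p\<bar> \<le> 1 \<Longrightarrow> \<bar>f x\<bar> \<le> B"
    "\<And>x y \<delta>. \<forall>p\<in>P. \<bar>x p\<bar> \<le> 1 \<Longrightarrow> \<forall>p\<in>P. \<bar>y p\<bar> \<le> 1 \<Longrightarrow> 0 \<le> \<delta> \<Longrightarrow>
      \<forall>p\<in>P. \<bar>x p - y p\<bar> \<le> \<delta> \<Longrightarrow> \<bar>f x - f y\<bar> \<le> B * \<delta>"
  shows "lipschitz_bound P f B"
  using assms unfolding lipschitz_bound_def by blast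

lemma lipschitz_boundD:
  assumes "lipschitz_bound P f B"
  shows "0 \<le> B" "\<forall>p\<in>P. \<bar>x p\<bar> \<le> 1 \<Longrightarrow> \<bar>f x\<bar> \<le> B"
    "\<forall>p\<in>P. \<bar>x p\<bar> \<le> 1 \<Longrightarrow> \<forall>p\<in>P. \<bar>y p\<bar> \<le> 1 \<Longrightarrow> 0 \<le> \<delta> \<Longrightarrow>
      \<forall>p\<in>P. \<bar>x p - y p\<bar> \<le> \<delta> \<Longrightarrow> \<bar>f x - f y\<bar> \<le> B * \<delta>"
  using assms unfolding lipschitz_bound_def by blast+

lemma poly_functions_lipschitz:
  assumes "f \<in> poly_functions P"
  shows "\<exists>B. lipschitz_bound P f B"
  using assms
proof induction
  case (const c)
  show ?case by (intro exI[of _ "\<bar>c\<bar>"] lipschitz_boundI) auto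
next
  case (coord j)
  then show ?case by (intro exI[of _ 1] lipschitz_boundI) auto
next
  case (add p q)
  then obtain A B where A: "lipschitz_bound P p A" and B: "lipschitz_bound P q B"
    by blast
  have "lipschitz_bound P (\<lambda>x. p x + q x) (A + B)"
  proof (rule lipschitz_boundI)
    fix x :: "'a \<Rightarrow> real" assume "\<forall>p\<in>P. \<bar>x p\<bar> \<le> 1"
    then have "\<bar>p x\<bar> \<le> A" "\<bar>q x\<bar> \<le> B"
      using lipschitz_boundD(2)[OF A] lipschitz_boundD(2)[OF B] by auto
    then show "\<bar>p x + q x\<bar> \<le> A + B" by linarith
  next
    fix x y :: "'a \<Rightarrow> real" and \<delta> :: real
    assume "\<forall>p\<in>P. \<bar>x p\<bar> \<le> 1" "\<forall>p\<in>P. \<bar>y p\<bar> \<le> 1" "0 \<le> \<delta>" "\<forall>p\<in>P. \<bar>x p - y p\<bar> \<le> \<delta>"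
    then have "\<bar>p x - p y\<bar> \<le> A * \<delta>" "\<bar>q x - q y\<bar> \<le> B * \<delta>"
      using lipschitz_boundD(3)[OF A] lipschitz_boundD(3)[OF B] by auto
    then show "\<bar>p x + q x - (p y + q y)\<bar> \<le> (A + B) * \<delta>"
      unfolding distrib_right by linarith
  qed (use lipschitz_boundD(1)[OF A] lipschitz_boundD(1)[OF B] in simp)
  then show ?case ..
next
  case (mult p q)
  then obtain A B where A: "lipschitz_bound P p A" and B: "lipschitz_bound P q B"
    by blast
  note AB = lipschitz_boundD(1)[OF A] lipschitz_boundD(1)[OF B]
  have AB': "0 \<le> A * B" using AB by simp
  \<comment> \<open>One \<open>A * B\<close> would do for the size; the second comes from the two
    terms of the product rule for differences.\<close>
  have "lipschitz_bound P (\<lambda>x. p x * q x) (A * B + A * B)"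
  proof (rule lipschitz_boundI)
    fix x :: "'a \<Rightarrow> real" assume "\<forall>p\<in>P. \<bar>x p\<bar> \<le> 1"
    then have "\<bar>p x * q x\<bar> \<le> A * B"
      unfolding abs_mult using lipschitz_boundD(2)[OF A] lipschitz_boundD(2)[OF B] AB
      by (intro mult_mono) auto
    with AB' show "\<bar>p x * q x\<bar> \<le> A * B + A * B" by linarith
  next
    fix x y :: "'a \<Rightarrow> real" and \<delta> :: real
    assume *: "\<forall>p\<in>P. \<bar>x p\<bar> \<le> 1" "\<forall>p\<in>P. \<bar>y p\<bar> \<le> 1" "0 \<le> \<delta>" "\<forall>p\<in>P. \<bar>x p - y p\<bar> \<le> \<delta>"
    have d: "\<bar>p x - p y\<bar> \<le> A * \<delta>" "\<bar>q x - q y\<bar> \<le> B * \<delta>"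
      using lipschitz_boundD(3)[OF A *] lipschitz_boundD(3)[OF B *] by auto
    have b: "\<bar>p x\<bar> \<le> A" "\<bar>q y\<bar> \<le> B"
      using lipschitz_boundD(2)[OF A *(1)] lipschitz_boundD(2)[OF B *(2)] by auto
    have "\<bar>p x * (q x - q y)\<bar> \<le> A * (B * \<delta>)"
      unfolding abs_mult using d b AB by (intro mult_mono) auto
    moreover have "\<bar>(p x - p y) * q y\<bar> \<le> (A * \<delta>) * B"
      unfolding abs_mult using d b AB *(3) by (intro mult_mono) auto
    moreover have "p x * q x - p y * q y = p x * (q x - q y) + (p x - p y) * q y"
      by (simp add: algebra_simps)
    moreover have "(A * B + A * B) * \<delta> = A * (B * \<delta>) + (A * \<delta>) * B"
      by (simp add: algebra_simps)
    ultimately show "\<bar>p x * q x - p y * q y\<bar> \<le> (A * B + A * B) * \<delta>"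
      by linarith
  qed (use AB' in simp)
  then show ?case ..
qed

lemma lipschitz_bound_mono:
  assumes "lipschitz_bound P f A" "A \<le> B"
  shows "lipschitz_bound P f B"
proof (rule lipschitz_boundI)
  show "0 \<le> B" using lipschitz_boundD(1)[OF assms(1)] assms(2) by linarith
  show "\<bar>f x\<bar> \<le> B" if "\<forall>p\<in>P. \<bar>x p\<bar> \<le> 1" for x
    using lipschitz_boundD(2)[OF assms(1) that] assms(2) by linarith
  fix x y :: "'a \<Rightarrow> real" and \<delta> :: real
  assume *: "\<forall>p\<in>P. \<bar>x p\<bar> \<le> 1" "\<forall>p\<in>P. \<bar>y p\<bar> \<le> 1" "0 \<le> \<delta>" "\<forall>p\<in>P. \<bar>x p - y p\<bar> \<le> \<delta>"
  have "A * \<delta> \<le> B * \<delta>"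
    using assms(2) *(3) by (rule mult_right_mono)
  with lipschitz_boundD(3)[OF assms(1) *] show "\<bar>f x - f y\<bar> \<le> B * \<delta>"
    by linarith
qed

section \<open>Counting grid points in polynomial images\<close>

lemma finite_uniform_lipschitz:
  assumes "finite A" "\<And>a. a \<in> A \<Longrightarrow> f a \<in> poly_functions P"
  shows "\<exists>L\<ge>0. \<forall>a\<in>A. lipschitz_bound P (f a) L"
proof -
  obtain B where B: "\<And>a. a \<in> A \<Longrightarrow> lipschitz_bound P (f a) (B a)"
    using poly_functions_lipschitz[OF assms(2)] by metis
  have "0 \<le> B a" if "a \<in> A" for a
    using B[OF that] by (rule lipschitz_boundD)
  then have "0 \<le> sum B A" "\<And>a. a \<in> A \<Longrightarrow> B a \<le> sum B A"
    using assms(1) by (auto intro: sum_nonneg member_le_sum)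
  then show ?thesis
    using B lipschitz_bound_mono by blast
qed

text \<open>Adding 1 moves the range [-1,1] to nonnegative numbers, where \<open>nat\<close> loses
  no information about the floor.\<close>

lemma floor_eq_imp_close:
  fixes s t :: real
  assumes "nat \<lfloor>(s + 1) * R\<rfloor> = nat \<lfloor>(t + 1) * R\<rfloor>" "0 < R" "\<bar>s\<bar> \<le> 1" "\<bar>t\<bar> \<le> 1"
  shows "\<bar>s - t\<bar> \<le> 1 / R"
proof -
  have "0 \<le> (s + 1) * R" "0 \<le> (t + 1) * R"
    using assms by auto
  then have "\<lfloor>(s + 1) * R\<rfloor> = \<lfloor>(t + 1) * R\<rfloor>"
    using assms(1) by (metis eq_nat_nat_iff zero_le_floor)
  then have "\<bar>(s + 1) * R - (t + 1) * R\<bar> < 1"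
    by linarith
  also have "(s + 1) * R - (t + 1) * R = (s - t) * R"
    by (simp add: algebra_simps)
  finally have "\<bar>s - t\<bar> * R < 1"
    using assms(2) by (simp add: abs_mult)
  then show ?thesis
    using assms(2) by (simp add: le_divide_eq)
qed

text \<open>Pigeonhole: if \<open>m = card P < card J = N\<close>, the box contains \<open>K\<^sup>N\<close> points of mutual
  distance \<open>\<epsilon> / K\<close>, whereas the images have only \<open>O(K\<^sup>m)\<close> cells of smaller diameter.\<close>

lemma poly_image_covers_box_imp_card_le:
  assumes fin: "finite J" "finite P" "finite F"
    and poly: "\<And>c j. c \<in> F \<Longrightarrow> j \<in> J \<Longrightarrow> f c j \<in> poly_functions P"
    and "0 < \<epsilon>"
    and cover: "\<And>x. \<forall>j\<in>J. a j \<le> x j \<and> x j \<le> a j + \<epsilon> \<Longrightarrow>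
      \<exists>c\<in>F. \<exists>t. (\<forall>p\<in>P. \<bar>t p\<bar> \<le> 1) \<and> (\<forall>j\<in>J. x j = f c j t)"
  shows "card J \<le> card P"
proof (rule ccontr)
  assume "\<not> ?thesis"
  then have less: "card P < card J" by simp
  have "\<And>b. b \<in> F \<times> J \<Longrightarrow> f (fst b) (snd b) \<in> poly_functions P"
    using poly by auto
  from finite_uniform_lipschitz[of "F \<times> J" "\<lambda>b. f (fst b) (snd b)", OF _ this] fin
  obtain L where "L \<ge> 0" and L': "\<forall>b\<in>F \<times> J. lipschitz_bound P (f (fst b) (snd b)) L"
    by auto
  have L: "lipschitz_bound P (f c j) L" if "c \<in> F" "j \<in> J" for c j
    using L'[rule_format, of "(c, j)"] that by simp
  \<comment> \<open>Parameter cells of side \<open>1 / (M * K)\<close> then have images of diameter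
    at most \<open>L / (M * K)\<close>, strictly below the grid spacing
    \<open>\<epsilon> / K\<close>.\<close>
  obtain M :: nat where M: "L / \<epsilon> < M"
    using reals_Archimedean2 by blast
  moreover have "0 \<le> L / \<epsilon>"
    using \<open>0 \<le> L\<close> \<open>0 < \<epsilon>\<close> by simp
  ultimately have "0 < M"
    by linarith
  have bound: "K ^ card J \<le> card F * (2 * M * K + 1) ^ card P" if "0 < K" for K :: nat
  proof -
    define V where "V = (\<Pi>\<^sub>E j\<in>J. {..<K})"
    define X where "X v j = a j + \<epsilon> * real (v j) / K" for v :: "'a \<Rightarrow> nat" and j
    have "\<forall>v\<in>V. \<exists>c\<in>F. \<exists>t. (\<forall>p\<in>P. \<bar>t p\<bar> \<le> 1) \<and> (\<forall>j\<in>J. X v j = f c j t)"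
    proof
      fix v assume v: "v \<in> V"
      have "\<epsilon> * real (v j) / K \<le> \<epsilon>" if "j \<in> J" for j
      proof -
        have "v j \<le> K" using v that by (force simp: V_def PiE_iff)
        then show ?thesis using \<open>0 < K\<close> \<open>0 < \<epsilon>\<close> by (simp add: divide_le_eq)
      qed
      then show "\<exists>c\<in>F. \<exists>t. (\<forall>p\<in>P. \<bar>t p\<bar> \<le> 1) \<and> (\<forall>j\<in>J. X v j = f c j t)"
        using \<open>0 < \<epsilon>\<close> by (intro cover) (auto simp: X_def)
    qed
    then obtain c t where c: "\<And>v. v \<in> V \<Longrightarrow> c v \<in> F"
      and t: "\<And>v p. v \<in> V \<Longrightarrow> p \<in> P \<Longrightarrow> \<bar>t v p\<bar> \<le> 1"
      and ct: "\<And>v j. v \<in> V \<Longrightarrow> j \<in> J \<Longrightarrow> X v j = f (c v) j (t v)"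
      by metis
    define R where "R = real (M * K)"
    have R: "0 < R" using \<open>0 < M\<close> \<open>0 < K\<close> by (simp add: R_def)
    \<comment> \<open>A grid point is encoded by a chart that reaches it and the cell containing its
      parameter; distinct grid points get distinct codes.\<close>
    define h where "h v = (c v, \<lambda>p\<in>P. nat \<lfloor>(t v p + 1) * R\<rfloor>)" for v
    \<comment> \<open>The upper index is included because a parameter equal to 1 falls into cell
      \<open>2 * M * K\<close>.\<close>
    define W where "W = F \<times> (\<Pi>\<^sub>E p\<in>P. {..2 * M * K})"
    have "inj_on h V"
    proof (rule inj_onI)
      fix v w assume vw: "v \<in> V" "w \<in> V" "h v = h w"
      then have cc: "c v = c w" and eq: "(\<lambda>p\<in>P. nat \<lfloor>(t v p + 1) * R\<rfloor>) = (\<lambda>p\<in>P. nat \<lfloor>(t w p + 1) * R\<rfloor>)"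
        by (auto simp: h_def)
      have "nat \<lfloor>(t v p + 1) * R\<rfloor> = nat \<lfloor>(t w p + 1) * R\<rfloor>" if "p \<in> P" for p
        using fun_cong[OF eq, of p] that by simp
      then have "\<forall>p\<in>P. \<bar>t v p - t w p\<bar> \<le> 1 / R"
        using R t vw by (auto intro: floor_eq_imp_close)
      then have close: "\<bar>X v j - X w j\<bar> \<le> L * (1 / R)" if "j \<in> J" for j
        using lipschitz_boundD(3)[OF L[OF c[OF vw(1)] that], of "t v" "t w" "1 / R"] t vw R that
        by (simp add: ct cc)
      have "v j = w j" if "j \<in> J" for j
      proof (rule ccontr)
        assume "v j \<noteq> w j"
        then have "1 \<le> \<bar>real (v j) - real (w j)\<bar>" by linarith
        have "X v j - X w j = \<epsilon> / K * (real (v j) - real (w j))"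
          by (simp add: X_def algebra_simps diff_divide_distrib)
        then have "\<bar>X v j - X w j\<bar> = \<epsilon> / K * \<bar>real (v j) - real (w j)\<bar>"
          using \<open>0 < \<epsilon>\<close> by (simp add: abs_mult)
        also have "\<dots> \<ge> \<epsilon> / K * 1"
          using \<open>1 \<le> \<bar>real (v j) - real (w j)\<bar>\<close> \<open>0 < \<epsilon>\<close> by (intro mult_left_mono) auto
        finally have "\<epsilon> / K \<le> L * (1 / R)"
          using close[OF that] by linarith
        then have "\<epsilon> * M \<le> L"
          using \<open>0 < K\<close> \<open>0 < M\<close> by (simp add: R_def field_simps)
        with M \<open>0 < \<epsilon>\<close> show False by (simp add: field_simps)
      qed
      then show "v = w"
        using vw by (auto simp: V_def intro: PiE_ext)
    qed
    moreover have "h ` V \<subseteq> W"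
    proof (clarsimp simp: h_def W_def c)
      fix v p assume vp: "v \<in> V" "p \<in> P"
      have "(t v p + 1) * R \<le> 2 * R"
        using t[OF vp] R by (intro mult_right_mono) auto
      then have "(t v p + 1) * R \<le> real (2 * M * K)"
        by (simp add: R_def)
      then have "\<lfloor>(t v p + 1) * R\<rfloor> \<le> int (2 * M * K)"
        by linarith
      then show "nat \<lfloor>(t v p + 1) * R\<rfloor> \<le> 2 * M * K"
        by linarith
    qed
    moreover have "finite W" using fin by (auto simp: W_def intro: finite_PiE)
    ultimately have "card V \<le> card W" by (metis card_inj_on_le)
    then show ?thesis
      using fin by (simp add: V_def W_def card_PiE card_cartesian_product)
  qed
  \<comment> \<open>The factor 3 absorbs the extra cell, as
    \<open>2 * M * K + 1 \<le> 3 * M * K\<close>. With \<open>m = card P\<close> the count gives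
    \<open>K ^ (m + 1) \<le> C * K ^ m\<close>, which \<open>K = C + 1\<close> refutes.\<close>
  define C where "C = card F * (3 * M) ^ card P"
  define K where "K = C + 1"
  have "K * K ^ card P \<le> K ^ card J"
    using less power_increasing[of "Suc (card P)" "card J" K] by (simp add: K_def)
  also have "\<dots> \<le> card F * (2 * M * K + 1) ^ card P"
    by (rule bound) (simp add: K_def)
  also have "\<dots> \<le> card F * (3 * M * K) ^ card P"
  proof -
    have "1 \<le> M * K" using \<open>0 < M\<close> by (simp add: K_def)
    then have "2 * M * K + 1 \<le> 3 * M * K" by linarith
    then show ?thesis by (intro mult_left_mono power_mono) auto
  qed
  also have "\<dots> = C * K ^ card P"
    by (simp add: C_def power_mult_distrib)
  finally show False by (simp add: K_def)
qed

section \<open>Cells and invariance of domain\<close>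

text \<open>A basic open set of the product topology restricts finitely many coordinates only, so
  one positive radius serves for all of them even over an infinite index type.\<close>

lemma open_imp_box:
  fixes x :: "'a \<Rightarrow> real"
  assumes "open T" "x \<in> T"
  obtains \<epsilon> where "0 < \<epsilon>" "\<And>y. (\<And>i. \<bar>y i - x i\<bar> < \<epsilon>) \<Longrightarrow> y \<in> T"
proof -
  have "openin (product_topology (\<lambda>i::'a. euclidean::real topology) UNIV) T"
    using assms(1) by (simp add: euclidean_product_topology)
  from product_topology_open_contains_basis[OF this assms(2)]
  obtain X where X: "x \<in> (\<Pi>\<^sub>E i\<in>UNIV. X i)" "\<And>i. open (X i)" "finite {i. X i \<noteq> UNIV}"
    "(\<Pi>\<^sub>E i\<in>UNIV. X i) \<subseteq> T"
    by auto
  define F where "F = {i. X i \<noteq> UNIV}"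
  have "\<exists>e>0. \<forall>y. \<bar>y - x i\<bar> < e \<longrightarrow> y \<in> X i" for i
    using X(2)[of i] X(1) unfolding open_dist dist_real_def by (auto simp: PiE_iff)
  then obtain e where e: "\<And>i. 0 < e i" "\<And>i y. \<bar>y - x i\<bar> < e i \<Longrightarrow> y \<in> X i"
    by metis
  \<comment> \<open>The element 1 keeps the minimum meaningful when no coordinate is
    restricted.\<close>
  define \<epsilon> where "\<epsilon> = Min (insert 1 (e ` F))"
  have fin: "finite (insert 1 (e ` F))" using X(3) by (simp add: F_def)
  show thesis
  proof (rule that)
    show "0 < \<epsilon>" using fin e(1) by (simp add: \<epsilon>_def)
    fix y assume y: "\<And>i. \<bar>y i - x i\<bar> < \<epsilon>"
    have "y i \<in> X i" for i
    proof (cases "i \<in> F")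
      case True
      then have "\<epsilon> \<le> e i" using fin by (auto simp: \<epsilon>_def)
      with y[of i] show ?thesis by (intro e(2)) linarith
    qed (simp add: F_def)
    then show "y \<in> T" using X(4) by (auto simp: PiE_iff)
  qed
qed

lemma openin_Euclidean_space_iff:
  "openin (Euclidean_space k) U \<longleftrightarrow> (\<exists>T. open T \<and> U = T \<inter> {x. \<forall>i\<ge>k. x i = 0})"
  unfolding Euclidean_space_def openin_subtopology euclidean_product_topology
  by simp

lemma openin_open_cube: "openin (Euclidean_space k) (open_cube k)"
proof -
  have "open {x :: nat \<Rightarrow> real. 0 < x i \<and> x i < 1}" for i
  proof -
    have "{x :: nat \<Rightarrow> real. 0 < x i \<and> x i < 1} = {x. 0 < x i} \<inter> {x. x i < 1}" by auto
    moreover have "open {x :: nat \<Rightarrow> real. 0 < x i}" "open {x :: nat \<Rightarrow> real. x i < 1}"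
      by (intro open_Collect_less continuous_intros continuous_on_product_coordinates)+
    ultimately show ?thesis by (simp add: open_Int)
  qed
  then have "open (\<Inter>i\<in>{..<k}. {x :: nat \<Rightarrow> real. 0 < x i \<and> x i < 1})"
    by (intro open_INT) auto
  moreover have "open_cube k = (\<Inter>i\<in>{..<k}. {x. 0 < x i \<and> x i < 1}) \<inter> {x. \<forall>i\<ge>k. x i = 0}"
    by (auto simp: open_cube_def real_space_def)
  ultimately show ?thesis
    unfolding openin_Euclidean_space_iff by blast
qed

lemma open_cube_ne: "open_cube k \<noteq> {}"
proof -
  have "(\<lambda>i. if i < k then 1 / 2 else 0) \<in> open_cube k"
    by (auto simp: open_cube_def real_space_def)
  then show ?thesis by blast
qed

text \<open>Both claims come from a single application, with R^k viewed inside R^m for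
  \<open>k \<le> m\<close>: the image is open in R^m. If \<open>k < m\<close>, moving a point of the
  image slightly in coordinate \<open>k\<close> leaves the image, where that coordinate
  vanishes.\<close>

lemma invariance_of_domain_open_cube:
  fixes h :: "(nat \<Rightarrow> real) \<Rightarrow> nat \<Rightarrow> real"
  assumes cont: "continuous_on (open_cube m) h" and inj: "inj_on h (open_cube m)"
    and im: "\<And>x i. x \<in> open_cube m \<Longrightarrow> k \<le> i \<Longrightarrow> h x i = 0"
  shows "m \<le> k" and "m = k \<Longrightarrow> openin (Euclidean_space k) (h ` open_cube m)"
proof -
  have cube: "open_cube m \<subseteq> {x. \<forall>i\<ge>m. x i = 0}"
    by (auto simp: open_cube_def real_space_def)
  have op: "openin (Euclidean_space m) (h ` open_cube m)" if "k \<le> m"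
  proof (rule invariance_of_domain_Euclidean_space[OF openin_open_cube])
    show "continuous_map (subtopology (Euclidean_space m) (open_cube m)) (Euclidean_space m) h"
      unfolding Euclidean_space_def euclidean_product_topology subtopology_subtopology
        continuous_map_in_subtopology
      using cont cube im that
      by (auto simp: continuous_map_iff_continuous Int_absorb1)
  qed (fact inj)
  then show "openin (Euclidean_space k) (h ` open_cube m)" if "m = k"
    using that by simp
  show "m \<le> k"
  proof (rule ccontr)
    assume "\<not> m \<le> k"
    then have "k < m" by simp
    with op obtain T where T: "open T" "h ` open_cube m = T \<inter> {x. \<forall>i\<ge>m. x i = 0}"
      by (auto simp: openin_Euclidean_space_iff)
    obtain x where x: "x \<in> h ` open_cube m"
      using open_cube_ne by blast
    then have "x \<in> T" and x0: "\<forall>i\<ge>m. x i = 0"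
      using T(2) by auto
    from open_imp_box[OF T(1) this(1)]
    obtain \<epsilon> where \<epsilon>: "0 < \<epsilon>" "\<And>y. (\<And>i. \<bar>y i - x i\<bar> < \<epsilon>) \<Longrightarrow> y \<in> T"
      by metis
    define y where "y = x(k := x k + \<epsilon> / 2)"
    have "y \<in> T" by (rule \<epsilon>(2)) (use \<epsilon>(1) in \<open>auto simp: y_def\<close>)
    moreover have "\<forall>i\<ge>m. y i = 0" using x0 \<open>k < m\<close> by (auto simp: y_def)
    ultimately have "y \<in> h ` open_cube m" using T(2) by auto
    then have "y k = 0" "x k = 0" using im x by auto
    then show False using \<epsilon>(1) by (simp add: y_def)
  qed
qed

section \<open>Cells with polynomial parametrisation\<close>

lemma poly_functions_subst:
  assumes "p \<in> poly_functions J" "h ` J \<subseteq> K"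
  shows "(\<lambda>y. p (\<lambda>i. y (h i))) \<in> poly_functions K"
  using assms(1)
proof induction
  case (coord j)
  then show ?case using assms(2) by (intro poly_functions.coord) auto
qed (auto intro: poly_functions.intros)

lemma semialgebraic_zero:
  assumes "p \<in> poly_functions J"
  shows "semialgebraic J {x \<in> real_space J. p x = 0}"
proof -
  have eq: "{x \<in> real_space J. p x = 0} =
    (real_space J - {x \<in> real_space J. p x > 0}) \<inter> (real_space J - {x \<in> real_space J. - p x > 0})"
    by auto
  show ?thesis
    unfolding eq using assms by (intro semialgebraic.intros poly_functions_minus)
qed

lemma semialgebraic_Ball:
  assumes "finite A" "\<And>a. a \<in> A \<Longrightarrow> semialgebraic J {x \<in> real_space J. P a x}"
  shows "semialgebraic J {x \<in> real_space J. \<forall>a\<in>A. P a x}"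
  using assms
proof (induction A rule: finite_induct)
  case empty
  have "semialgebraic J {x \<in> real_space J. 0 < (1::real)}"
    by (rule semialgebraic.pos) (rule poly_functions.const)
  then show ?case by simp
next
  case (insert a A)
  have "{x \<in> real_space J. \<forall>b\<in>insert a A. P b x} =
    {x \<in> real_space J. P a x} \<inter> {x \<in> real_space J. \<forall>b\<in>A. P b x}" by auto
  then show ?case using insert by (auto intro: semialgebraic.inter)
qed

text \<open>The graph is cut out directly by the inequalities of the cube in the \<open>Inl\<close>
  coordinates and one polynomial equation for each \<open>Inr\<close> coordinate.\<close>

lemma semialgebraic_cell_poly:
  fixes J :: "'j set"
  assumes "finite J" "homeomorphism (open_cube k) (f ` open_cube k) f g"
    and poly: "\<And>j. j \<in> J \<Longrightarrow> (\<lambda>x. f x j) \<in> poly_functions {..<k}"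
    and supp: "\<And>x j. j \<notin> J \<Longrightarrow> f x j = 0"
  shows "semialgebraic_cell J k (f ` open_cube k)"
proof -
  define K where "K = {..<k} <+> J"
  \<comment> \<open>Both inequalities have the form of a polynomial being positive, as the
    generators of \<open>semialgebraic\<close> require.\<close>
  define Pos where "Pos i y \<longleftrightarrow> 0 < y (Inl i) \<and> 0 < 1 - y (Inl i)" for i and y :: "nat + 'j \<Rightarrow> real"
  define Eq where "Eq j y \<longleftrightarrow> y (Inr j) - f (\<lambda>i. y (Inl i)) j = 0" for j and y :: "nat + 'j \<Rightarrow> real"
  have graph: "(\<lambda>x. case_sum x (f x)) ` open_cube k =
    {y \<in> real_space K. \<forall>i\<in>{..<k}. Pos i y} \<inter> {y \<in> real_space K. \<forall>j\<in>J. Eq j y}" (is "?L = ?R")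
  proof
    show "?L \<subseteq> ?R"
      using supp
      by (auto simp: open_cube_def real_space_def K_def Pos_def Eq_def split: sum.split; blast)
    show "?R \<subseteq> ?L"
    proof
      fix y assume y: "y \<in> ?R"
      define x where "x = (\<lambda>i. y (Inl i))"
      have "x \<in> open_cube k"
        using y by (auto simp: x_def open_cube_def real_space_def K_def Pos_def)
      moreover have "y (Inr j) = f x j" for j
        using y supp[of j x] by (cases "j \<in> J") (auto simp: x_def Eq_def real_space_def K_def)
      then have "y = case_sum x (f x)"
        by (auto simp: x_def fun_eq_iff split: sum.split)
      ultimately show "y \<in> ?L" by blast
    qed
  qed
  have "semialgebraic K {y \<in> real_space K. \<forall>i\<in>{..<k}. Pos i y}"
  proof (rule semialgebraic_Ball)
    fix i assume "i \<in> {..<k}"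
    then have i: "Inl i \<in> K" by (auto simp: K_def)
    have eq: "{y \<in> real_space K. Pos i y} = {y \<in> real_space K. 0 < y (Inl i)} \<inter> {y \<in> real_space K. 0 < 1 - y (Inl i)}"
      by (auto simp: Pos_def)
    show "semialgebraic K {y \<in> real_space K. Pos i y}"
      unfolding eq using i
      by (intro semialgebraic.inter semialgebraic.pos poly_functions_diff poly_functions.intros)
  qed simp
  moreover have "semialgebraic K {y \<in> real_space K. \<forall>j\<in>J. Eq j y}"
  proof (rule semialgebraic_Ball[OF \<open>finite J\<close>])
    fix j assume j: "j \<in> J"
    then show "semialgebraic K {y \<in> real_space K. Eq j y}"
      unfolding Eq_def
      by (intro semialgebraic_zero poly_functions_diff poly_functions.coord
          poly_functions_subst[OF poly[OF j], of Inl]) (auto simp: K_def)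
  qed
  ultimately have "semialgebraic K ((\<lambda>x. case_sum x (f x)) ` open_cube k)"
    unfolding graph by (rule semialgebraic.inter)
  then have "semialgebraic_map {..<k} J (open_cube k) f"
    using supp by (auto simp: semialgebraic_map_def K_def open_cube_def real_space_def)
  with assms(2) show ?thesis
    unfolding semialgebraic_cell_def by blast
qed

text \<open>Ensures that a nonempty set contains some cell, so that the maximum defining its
  dimension is attained.\<close>

lemma semialgebraic_cell_point:
  assumes "finite J" "a \<in> real_space J"
  shows "semialgebraic_cell J 0 {a}"
proof -
  have cube: "open_cube 0 = {\<lambda>_. 0}"
    by (auto simp: open_cube_def real_space_def)
  have "semialgebraic_cell J 0 ((\<lambda>_. a) ` open_cube 0)"
    using assms
    by (intro semialgebraic_cell_poly[where g = "\<lambda>_ _. 0"])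
      (auto simp: cube real_space_def homeomorphism_def intro: poly_functions.const)
  then show ?thesis by (simp add: cube)
qed

section \<open>Real coordinates of Hermitian operators\<close>

text \<open>For Hermitian \<open>A\<close> the entries \<open>A i j\<close> and \<open>A j i\<close> have the same real part and opposite
  imaginary parts, so the sums of real and imaginary parts of the entries form a real coordinate
  system that does not require an ordering of \<open>I\<close>.\<close>

definition herm_coord :: "('i \<Rightarrow> 'i \<Rightarrow> complex) \<Rightarrow> 'i \<times> 'i \<Rightarrow> real" where
  "herm_coord A = (\<lambda>(i, j). Re (A i j) + Im (A i j))"

definition hyperplane :: "'i set \<Rightarrow> ('i \<Rightarrow> 'i \<Rightarrow> complex) set" where
  "hyperplane I = {A \<in> hermitian_operators I. op_trace I A = 1}"

lemma Re_Im_herm_coord: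
  assumes "A \<in> hermitian_operators I"
  shows "Re (A i j) = (herm_coord A (i, j) + herm_coord A (j, i)) / 2"
    and "Im (A i j) = (herm_coord A (i, j) - herm_coord A (j, i)) / 2"
proof -
  have "A j i = cnj (A i j)" using assms unfolding hermitian_operators_def by blast
  then show "Re (A i j) = (herm_coord A (i, j) + herm_coord A (j, i)) / 2"
    and "Im (A i j) = (herm_coord A (i, j) - herm_coord A (j, i)) / 2"
    by (simp_all add: herm_coord_def)
qed

lemma hermitian_outside:
  assumes "A \<in> hermitian_operators I" "i \<notin> I \<or> j \<notin> I"
  shows "A i j = 0"
  using assms unfolding hermitian_operators_def operators_def by blast

lemma hermitian_eqI:
  assumes "A \<in> hermitian_operators I" "B \<in> hermitian_operators I"
    and "\<And>i j. i \<in> I \<Longrightarrow> j \<in> I \<Longrightarrow> herm_coord A (i, j) = herm_coord B (i, j)"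
  shows "A = B"
proof (intro ext)
  fix i j
  show "A i j = B i j"
  proof (cases "i \<in> I \<and> j \<in> I")
    case True
    then show ?thesis
      using assms by (simp add: complex_eq_iff Re_Im_herm_coord[OF assms(1)] Re_Im_herm_coord[OF assms(2)])
  next
    case False
    then show ?thesis
      using assms(1,2) by (simp add: hermitian_outside[of _ I])
  qed
qed

lemma hyperplane_trace:
  assumes "A \<in> hyperplane I"
  shows "(\<Sum>i\<in>I. herm_coord A (i, i)) = 1"
proof -
  have "Im (A i i) = 0" for i
    using Re_Im_herm_coord(2)[of A I i i] assms by (simp add: hyperplane_def)
  then have "(\<Sum>i\<in>I. herm_coord A (i, i)) = Re (op_trace I A)"
    by (simp add: herm_coord_def op_trace_def)
  then show ?thesis using assms by (simp add: hyperplane_def)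
qed

text \<open>On the hyperplane the trace determines the diagonal coordinate at \<open>i0\<close>. The
  other entries, enumerated by \<open>e\<close>, are global coordinates, and \<open>k\<close> is the
  dimension of the hyperplane.\<close>

locale hyperplane_coords =
  fixes I :: "'i set" and i0 :: 'i and k :: nat and e :: "nat \<Rightarrow> 'i \<times> 'i"
  assumes fin: "finite I" and i0: "i0 \<in> I"
    and e: "bij_betw e {..<k} (I \<times> I - {(i0, i0)})"
begin

text \<open>The argument is a vector of real coordinates because cells live there. Padding with
  zeros beyond \<open>k\<close> places the values in \<open>Euclidean_space k\<close>.\<close>

definition affine_coords :: "('i \<times> 'i \<times> bool \<Rightarrow> real) \<Rightarrow> nat \<Rightarrow> real" where
  "affine_coords y = (\<lambda>q. if q < k then y (fst (e q), snd (e q), False) + y (fst (e q), snd (e q), True) else 0)"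

lemma affine_coords_real_coords: "affine_coords (real_coords A) q = (if q < k then herm_coord A (e q) else 0)"
  by (simp add: affine_coords_def real_coords_def herm_coord_def case_prod_beta)

lemma continuous_affine_coords: "continuous_on S affine_coords"
proof (rule continuous_on_coordinatewise_then_product)
  fix q
  have "continuous_on UNIV (\<lambda>y. affine_coords y q)"
    unfolding affine_coords_def by (cases "q < k") (auto intro!: continuous_intros)
  then show "continuous_on S (\<lambda>y. affine_coords y q)"
    by (rule continuous_on_subset) simp
qed

lemma card_eq: "Suc k = (card I)\<^sup>2"
proof -
  have "k = card (I \<times> I - {(i0, i0)})"
    using bij_betw_same_card[OF e] by simp
  also have "\<dots> = (card I)\<^sup>2 - 1"
    using i0 by (subst card_Diff_singleton) (auto simp: card_cartesian_product power2_eq_square)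
  finally show ?thesis
    using i0 fin by (metis Suc_diff_1 card_gt_0_iff empty_iff zero_less_power)
qed

lemma corner_coord:
  "x (i0, i0) = (\<Sum>i\<in>I. x (i, i)) - (\<Sum>i\<in>I - {i0}. x (i, i))" for x :: "'i \<times> 'i \<Rightarrow> real"
  using sum.remove[OF fin i0, of "\<lambda>i. x (i, i)"] by simp

text \<open>Only the diagonal sums have to agree, not to equal 1, because the lemma is also applied
  to scaled states in the cone.\<close>

lemma coords_eqI:
  fixes x y :: "'i \<times> 'i \<Rightarrow> real"
  assumes "\<And>q. q < k \<Longrightarrow> x (e q) = y (e q)" "(\<Sum>i\<in>I. x (i, i)) = (\<Sum>i\<in>I. y (i, i))"
    and "ij \<in> I \<times> I"
  shows "x ij = y ij"
proof -
  have off: "x ij = y ij" if "ij \<in> I \<times> I - {(i0, i0)}" for ij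
  proof -
    have "ij \<in> e ` {..<k}" using that e by (simp add: bij_betw_def)
    then show ?thesis using assms(1) by auto
  qed
  then have "(\<Sum>i\<in>I - {i0}. x (i, i)) = (\<Sum>i\<in>I - {i0}. y (i, i))"
    by (intro sum.cong) auto
  then have "x (i0, i0) = y (i0, i0)"
    using assms(2) corner_coord[of x] corner_coord[of y] by simp
  with off assms(3) show ?thesis by blast
qed

lemma inj_on_affine_coords: "inj_on affine_coords (real_coords ` hyperplane I)"
proof (rule inj_onI, elim imageE, simp)
  fix A B :: "'i \<Rightarrow> 'i \<Rightarrow> complex" assume AB: "A \<in> hyperplane I" "B \<in> hyperplane I"
    and eq: "affine_coords (real_coords A) = affine_coords (real_coords B)"
  have "herm_coord A ij = herm_coord B ij" if "ij \<in> I \<times> I" for ij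
  proof (rule coords_eqI[OF _ _ that])
    show "herm_coord A (e q) = herm_coord B (e q)" if "q < k" for q
      using fun_cong[OF eq, of q] that by (simp add: affine_coords_real_coords)
    show "(\<Sum>i\<in>I. herm_coord A (i, i)) = (\<Sum>i\<in>I. herm_coord B (i, i))"
      using AB by (simp add: hyperplane_trace)
  qed
  then have "A = B"
    using AB by (intro hermitian_eqI[of A I B]) (auto simp: hyperplane_def)
  then show "real_coords A = real_coords B" by simp
qed

text \<open>Following the parametrisation of the cell by \<open>affine_coords\<close> gives a
  continuous injection of a cube into R^k, to which invariance of domain applies.\<close>

lemma cell_in_hyperplane:
  assumes "semialgebraic_cell J m C" "C \<subseteq> real_coords ` hyperplane I"
  shows "m \<le> k" and "m = k \<Longrightarrow> openin (Euclidean_space k) (affine_coords ` C)" and "C \<noteq> {}"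
proof -
  obtain f g where fg: "homeomorphism (open_cube m) C f g"
    using assms(1) by (auto simp: semialgebraic_cell_def)
  have C: "f ` open_cube m = C" using fg by (simp add: homeomorphism_def)
  have "inj_on f (open_cube m)"
    using fg by (metis homeomorphism_def inj_on_inverseI)
  then have inj: "inj_on (affine_coords \<circ> f) (open_cube m)"
    using inj_on_subset[OF inj_on_affine_coords assms(2)] C by (simp add: comp_inj_on)
  have cont: "continuous_on (open_cube m) (affine_coords \<circ> f)"
    using fg by (intro continuous_on_compose continuous_affine_coords) (simp add: homeomorphism_def)
  have im: "(affine_coords \<circ> f) x i = 0" if "x \<in> open_cube m" "k \<le> i" for x i
    using that(2) by (simp add: affine_coords_def)
  note * = invariance_of_domain_open_cube[where k = k, OF cont inj im]
  show "m \<le> k" by (rule *(1))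
  show "openin (Euclidean_space k) (affine_coords ` C)" if "m = k"
    using *(2)[unfolded image_comp[symmetric] C] that by simp
  show "C \<noteq> {}" using C open_cube_ne by auto
qed

text \<open>\<open>Max\<close> is meaningful for finite sets only, so this bound is what allows
  computing with \<open>semialgebraic_dim\<close>.\<close>

lemma finite_cell_dims:
  assumes "A \<subseteq> real_coords ` hyperplane I"
  shows "{m. \<exists>C\<subseteq>A. semialgebraic_cell J m C} \<subseteq> {..k}"
  using cell_in_hyperplane(1) assms by fastforce

lemma semialgebraic_dim_eqI:
  assumes "A \<subseteq> real_coords ` hyperplane I" "C \<subseteq> A" "semialgebraic_cell J k C"
  shows "semialgebraic_dim J A = int k"
proof -
  have "Max {m. \<exists>C\<subseteq>A. semialgebraic_cell J m C} = k"
  proof (rule Max_eqI)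
    show "finite {m. \<exists>C\<subseteq>A. semialgebraic_cell J m C}"
      using finite_cell_dims[OF assms(1)] by (rule finite_subset) simp
    show "m \<le> k" if "m \<in> {m. \<exists>C\<subseteq>A. semialgebraic_cell J m C}" for m
      using finite_cell_dims[OF assms(1)] that by blast
  qed (use assms in blast)
  moreover have "A \<noteq> {}"
    using cell_in_hyperplane(3)[OF assms(3)] assms by blast
  ultimately show ?thesis by (simp add: semialgebraic_dim_def)
qed

lemma semialgebraic_dim_eqD:
  assumes "A \<subseteq> real_coords ` hyperplane I" "semialgebraic_dim J A = int k"
    and "finite J" "A \<subseteq> real_space J"
  shows "\<exists>C\<subseteq>A. semialgebraic_cell J k C"
proof -
  let ?D = "{m. \<exists>C\<subseteq>A. semialgebraic_cell J m C}"
  \<comment> \<open>The empty set has dimension -1, which differs from every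
    \<open>int k\<close>.\<close>
  have "A \<noteq> {}" using assms(2) by (auto simp: semialgebraic_dim_def)
  then obtain a where "a \<in> A" by blast
  then have "semialgebraic_cell J 0 {a}" "{a} \<subseteq> A"
    using assms by (auto intro: semialgebraic_cell_point)
  then have "?D \<noteq> {}" by blast
  moreover have "finite ?D"
    using finite_cell_dims[OF assms(1)] by (rule finite_subset) simp
  moreover have "Max ?D = k"
    using assms(2) \<open>A \<noteq> {}\<close> by (simp add: semialgebraic_dim_def)
  ultimately have "k \<in> ?D" using Max_in by metis
  then show ?thesis by simp
qed

text \<open>Division by the trace is continuous where the trace is positive, so the points whose
  normalisation lies in the open cell form an open set; each of them is its trace times a state in
  \<open>X\<close>.\<close>

lemma cone_contains_box:
  assumes "semialgebraic_cell J k C" "C \<subseteq> real_coords ` X" "X \<subseteq> hyperplane I"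
  obtains a \<epsilon> where "0 < \<epsilon>"
    "\<And>x. \<forall>ij\<in>I \<times> I. a ij \<le> x ij \<and> x ij \<le> a ij + \<epsilon> \<Longrightarrow>
      \<exists>\<rho>\<in>X. \<exists>s. 0 < s \<and> s \<le> 1 \<and> (\<forall>ij\<in>I \<times> I. x ij = s * herm_coord \<rho> ij)"
proof -
  have CH: "C \<subseteq> real_coords ` hyperplane I" using assms by blast
  have "openin (Euclidean_space k) (affine_coords ` C)"
    by (rule cell_in_hyperplane(2)[OF assms(1) CH refl])
  then obtain T where T: "open T" "affine_coords ` C = T \<inter> {x. \<forall>i\<ge>k. x i = 0}"
    by (auto simp: openin_Euclidean_space_iff)
  obtain \<rho>0 where \<rho>0: "\<rho>0 \<in> X" "real_coords \<rho>0 \<in> C"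
    using cell_in_hyperplane(3)[OF assms(1) CH] assms(2) by blast
  define tr where "tr x = (\<Sum>i\<in>I. x (i, i))" for x :: "'i \<times> 'i \<Rightarrow> real"
  define \<Phi> where "\<Phi> x q = (if q < k then x (e q) / tr x else 0)" for x q
  \<comment> \<open>The upper bound on the trace becomes \<open>s \<le> 1\<close>, which later keeps
    the chart weights inside the parameter cube.\<close>
  define U where "U = {x. 0 < tr x} \<inter> {x. tr x < 1}"
  have tr_cont: "continuous_on UNIV tr"
    unfolding tr_def by (intro continuous_intros continuous_on_product_coordinates)
  have "open U"
    unfolding U_def by (intro open_Int open_Collect_less tr_cont continuous_intros)
  have "continuous_on U \<Phi>"
  proof (rule continuous_on_coordinatewise_then_product)
    fix q
    have "continuous_on U (\<lambda>x. x (e q) / tr x)"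
    proof (rule continuous_on_divide)
      show "continuous_on U (\<lambda>x. x (e q))"
        by (rule continuous_on_subset[OF continuous_on_product_coordinates]) simp
      show "continuous_on U tr" by (rule continuous_on_subset[OF tr_cont]) simp
    qed (auto simp: U_def)
    then show "continuous_on U (\<lambda>x. \<Phi> x q)"
      by (cases "q < k") (auto simp: \<Phi>_def)
  qed
  then have W: "open (U \<inter> \<Phi> -` T)"
    using \<open>open U\<close> T(1) by (rule continuous_open_preimage)
  \<comment> \<open>Halving moves the trace to 1/2, inside the open range of \<open>U\<close>, while
    the normalisation remains the chosen point of the cell.\<close>
  define a where "a ij = herm_coord \<rho>0 ij / 2" for ij
  have \<rho>0H: "\<rho>0 \<in> hyperplane I" using \<rho>0 assms(3) by blast
  have "tr a = 1 / 2"
    using hyperplane_trace[OF \<rho>0H] by (simp add: tr_def a_def flip: sum_divide_distrib)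
  then have "a \<in> U" by (simp add: U_def)
  moreover have "\<Phi> a = affine_coords (real_coords \<rho>0)"
    unfolding \<Phi>_def \<open>tr a = 1 / 2\<close> by (simp add: fun_eq_iff affine_coords_real_coords a_def)
  then have "\<Phi> a \<in> T" using \<rho>0(2) T(2) by blast
  ultimately have "a \<in> U \<inter> \<Phi> -` T" by simp
  from open_imp_box[OF W this] obtain \<epsilon>
    where \<epsilon>: "0 < \<epsilon>" "\<And>y. (\<And>ij. \<bar>y ij - a ij\<bar> < \<epsilon>) \<Longrightarrow> y \<in> U \<inter> \<Phi> -` T"
    by metis
  show thesis
  \<comment> \<open>The closed box of half the side satisfies the strict inequalities of the open
    neighbourhood.\<close>
  proof (rule that[of "\<epsilon> / 2" a])
    show "0 < \<epsilon> / 2" using \<epsilon>(1) by simp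
    fix x assume x: "\<forall>ij\<in>I \<times> I. a ij \<le> x ij \<and> x ij \<le> a ij + \<epsilon> / 2"
    \<comment> \<open>The neighbourhood constrains every index, whereas the box speaks of
      \<open>I \<times> I\<close> alone; elsewhere \<open>x'\<close> stays at the centre.\<close>
    define x' where "x' ij = (if ij \<in> I \<times> I then x ij else a ij)" for ij
    have "x' \<in> U \<inter> \<Phi> -` T"
    proof (rule \<epsilon>(2))
      fix ij show "\<bar>x' ij - a ij\<bar> < \<epsilon>"
        using x[rule_format, of ij] \<epsilon>(1) by (cases "ij \<in> I \<times> I") (auto simp: x'_def)
    qed
    then have "x' \<in> U" "\<Phi> x' \<in> affine_coords ` C"
      using T(2) by (auto simp: \<Phi>_def)
    then obtain \<rho> where \<rho>: "\<rho> \<in> X" "\<Phi> x' = affine_coords (real_coords \<rho>)"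
      using assms(2) by blast
    have "x' ij = tr x' * herm_coord \<rho> ij" if "ij \<in> I \<times> I" for ij
    proof (rule coords_eqI[OF _ _ that])
      show "x' (e q) = tr x' * herm_coord \<rho> (e q)" if "q < k" for q
        using fun_cong[OF \<rho>(2), of q] that \<open>x' \<in> U\<close> by (simp add: \<Phi>_def affine_coords_real_coords U_def field_simps)
      have "\<rho> \<in> hyperplane I" using \<rho>(1) assms(3) by blast
      then show "(\<Sum>i\<in>I. x' (i, i)) = (\<Sum>i\<in>I. tr x' * herm_coord \<rho> (i, i))"
        by (simp add: hyperplane_trace tr_def flip: sum_distrib_left)
    qed
    then have "\<forall>ij\<in>I \<times> I. x ij = tr x' * herm_coord \<rho> ij"
      by (auto simp: x'_def)
    moreover have "0 < tr x'" "tr x' \<le> 1" using \<open>x' \<in> U\<close> by (auto simp: U_def)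
    ultimately show "\<exists>\<rho>\<in>X. \<exists>s. 0 < s \<and> s \<le> 1 \<and> (\<forall>ij\<in>I \<times> I. x ij = s * herm_coord \<rho> ij)"
      using \<rho>(1) by blast
  qed
qed

end

section \<open>Sums of product projectors\<close>

lemma ketbra_scale: "ketbra (\<lambda>a. c * z a) a b = of_real ((cmod c)\<^sup>2) * ketbra z a b"
  unfolding ketbra_def complex_norm_square by simp

text \<open>Keeping the weights apart from the vectors makes the operator linear in them. Positive
  weights are turned back into a product decomposition by moving their square roots into the
  vectors.\<close>

definition weighted_ketbras :: "'k set \<Rightarrow> ('k \<Rightarrow> real) \<Rightarrow> ('k \<Rightarrow> 'i \<Rightarrow> complex) \<Rightarrow> 'i \<Rightarrow> 'i \<Rightarrow> complex" where
  "weighted_ketbras K \<mu> z = (\<lambda>a b. \<Sum>k\<in>K. of_real (\<mu> k) * ketbra (z k) a b)"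

lemma weighted_ketbras_hermitian:
  assumes "\<And>k. k \<in> K \<Longrightarrow> z k \<in> coord_space I"
  shows "weighted_ketbras K \<mu> z \<in> hermitian_operators I"
  unfolding hermitian_operators_def operators_def
proof (intro CollectI conjI allI impI)
  fix i j
  show "weighted_ketbras K \<mu> z i j = 0" if "i \<notin> I \<or> j \<notin> I"
    using assms that unfolding weighted_ketbras_def
    by (intro sum.neutral) (auto simp: ketbra_def coord_space_def)
  show "weighted_ketbras K \<mu> z j i = cnj (weighted_ketbras K \<mu> z i j)"
    by (simp add: weighted_ketbras_def ketbra_def mult.commute)
qed

lemma herm_coord_weighted_ketbras:
  "herm_coord (weighted_ketbras K \<mu> z) ij = (\<Sum>k\<in>K. \<mu> k * herm_coord (ketbra (z k)) ij)"
  by (cases ij) (simp add: herm_coord_def weighted_ketbras_def distrib_left sum.distrib)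

lemma op_trace_weighted_ketbras:
  "op_trace I (weighted_ketbras K \<mu> z) = of_real (\<Sum>k\<in>K. \<mu> k * (\<Sum>a\<in>I. (cmod (z k a))\<^sup>2))"
proof -
  have "op_trace I (weighted_ketbras K \<mu> z) = (\<Sum>k\<in>K. \<Sum>a\<in>I. of_real (\<mu> k) * (z k a * cnj (z k a)))"
    unfolding op_trace_def weighted_ketbras_def ketbra_def by (rule sum.swap)
  then show ?thesis
    by (simp add: sum_distrib_left flip: complex_norm_square)
qed

lemma hinner_weighted_ketbras:
  "hinner I v (op_apply I (weighted_ketbras K \<mu> z) v) =
    of_real (\<Sum>k\<in>K. \<mu> k * (cmod (\<Sum>j\<in>I. cnj (z k j) * v j))\<^sup>2)"
proof -
  have "hinner I v (op_apply I (weighted_ketbras K \<mu> z) v) =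
    (\<Sum>i\<in>I. \<Sum>j\<in>I. \<Sum>k\<in>K. of_real (\<mu> k) * (cnj (v i) * z k i * (cnj (z k j) * v j)))"
    by (simp add: hinner_def op_apply_def weighted_ketbras_def ketbra_def sum_distrib_left
        sum_distrib_right mult_ac)
  also have "\<dots> = (\<Sum>i\<in>I. \<Sum>k\<in>K. \<Sum>j\<in>I. of_real (\<mu> k) * (cnj (v i) * z k i * (cnj (z k j) * v j)))"
    by (intro sum.cong refl sum.swap)
  also have "\<dots> = (\<Sum>k\<in>K. \<Sum>i\<in>I. \<Sum>j\<in>I. of_real (\<mu> k) * (cnj (v i) * z k i * (cnj (z k j) * v j)))"
    by (rule sum.swap)
  also have "\<dots> = (\<Sum>k\<in>K. of_real (\<mu> k) *
      ((\<Sum>j\<in>I. cnj (z k j) * v j) * cnj (\<Sum>j\<in>I. cnj (z k j) * v j)))"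
    by (simp add: sum_product sum_distrib_left mult_ac)
  also have "\<dots> = of_real (\<Sum>k\<in>K. \<mu> k * (cmod (\<Sum>j\<in>I. cnj (z k j) * v j))\<^sup>2)"
    unfolding complex_norm_square[symmetric] by simp
  finally show ?thesis .
qed

lemma weighted_ketbras_psd:
  assumes "\<And>k. k \<in> K \<Longrightarrow> z k \<in> coord_space I" "\<And>k. k \<in> K \<Longrightarrow> 0 \<le> \<mu> k"
  shows "positive_semidefinite I (weighted_ketbras K \<mu> z)"
  unfolding positive_semidefinite_def hinner_weighted_ketbras
  using assms by (auto intro!: weighted_ketbras_hermitian sum_nonneg)

section \<open>Product vectors and separable states\<close>

lemma finite_multi_indices: "finite (multi_indices n d)"
  by (simp add: multi_indices_def finite_PiE)

lemma card_multi_indices: "card (multi_indices n d) = total_dim n d"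
  by (simp add: multi_indices_def total_dim_def card_PiE)

lemma trace_one_hyperplane_eq: "trace_one_hyperplane n d = hyperplane (multi_indices n d)"
  by (simp add: trace_one_hyperplane_def hyperplane_def)

lemma product_vector_coord_space:
  "product_vector n d z \<Longrightarrow> z \<in> coord_space (multi_indices n d)"
  by (auto simp: product_vector_def coord_space_def tensor_vec_def)

lemma product_vector_scale:
  assumes "product_vector n d z" "c \<noteq> 0" "0 < n"
  shows "product_vector n d (\<lambda>a. c * z a)"
proof -
  obtain x where x: "\<forall>i<n. x i \<in> coord_space {..<d i}" "z = tensor_vec n d x"
    using assms by (auto simp: product_vector_def)
  \<comment> \<open>The scalar is absorbed by the factor of party 0, which exists because
    \<open>0 < n\<close>.\<close>
  define y where "y = x(0 := (\<lambda>j. c * x 0 j))"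
  have "(\<Prod>i<n. y i (a i)) = c * (\<Prod>i<n. x i (a i))" for a
  proof -
    have "(\<Prod>i\<in>{..<n} - {0}. y i (a i)) = (\<Prod>i\<in>{..<n} - {0}. x i (a i))"
      by (intro prod.cong) (auto simp: y_def)
    then show ?thesis
      using assms(3) prod.remove[of "{..<n}" 0 "\<lambda>i. y i (a i)"] prod.remove[of "{..<n}" 0 "\<lambda>i. x i (a i)"]
      by (simp add: y_def mult.assoc)
  qed
  then have "(\<lambda>a. c * z a) = tensor_vec n d y"
    by (simp add: x(2) tensor_vec_def fun_eq_iff)
  moreover have "\<forall>i<n. y i \<in> coord_space {..<d i}"
    using x(1) by (auto simp: y_def coord_space_def)
  moreover have "(\<lambda>a. c * z a) \<noteq> (\<lambda>_. 0)"
    using assms(1,2) by (auto simp: product_vector_def fun_eq_iff)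
  ultimately show ?thesis by (auto simp: product_vector_def)
qed

lemma product_decomposition_weighted:
  assumes "product_decomposition n d \<rho> l z"
  shows "\<rho> = weighted_ketbras {..<l} (\<lambda>_. 1) z"
  using assms by (simp add: product_decomposition_def weighted_ketbras_def)

lemma weighted_product_decomposition:
  assumes "finite K" "0 < n" "\<And>k. k \<in> K \<Longrightarrow> product_vector n d (z k)" "\<And>k. k \<in> K \<Longrightarrow> 0 < \<mu> k"
  shows "\<exists>z'. product_decomposition n d (weighted_ketbras K \<mu> z) (card K) z'"
proof -
  obtain h where h: "bij_betw h {0..<card K} K"
    using ex_bij_betw_nat_finite[OF assms(1)] by blast
  define z' where "z' m = (\<lambda>a. of_real (sqrt (\<mu> (h m))) * z (h m) a)" for m
  have hK: "h m \<in> K" if "m < card K" for m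
    using h that by (auto simp: bij_betw_def)
  have "product_vector n d (z' m)" if "m < card K" for m
    using assms(2) assms(3,4)[OF hK[OF that]] unfolding z'_def
    by (intro product_vector_scale) auto
  moreover have "weighted_ketbras K \<mu> z a b = (\<Sum>m<card K. ketbra (z' m) a b)" for a b
  proof -
    have "weighted_ketbras K \<mu> z a b = (\<Sum>m\<in>{0..<card K}. of_real (\<mu> (h m)) * ketbra (z (h m)) a b)"
      unfolding weighted_ketbras_def by (rule sum.reindex_bij_betw[OF h, symmetric])
    also have "\<dots> = (\<Sum>m<card K. ketbra (z' m) a b)"
    proof (rule sum.cong)
      fix m assume "m \<in> {..<card K}"
      then have "0 \<le> \<mu> (h m)" using assms(4) hK by (simp add: less_imp_le)
      then show "of_real (\<mu> (h m)) * ketbra (z (h m)) a b = ketbra (z' m) a b"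
        unfolding z'_def ketbra_scale by simp
    qed auto
    finally show ?thesis .
  qed
  ultimately show ?thesis
    unfolding product_decomposition_def by blast
qed

lemma weighted_ketbras_sep_state:
  assumes "finite K" "0 < n" "\<And>k. k \<in> K \<Longrightarrow> product_vector n d (z k)" "\<And>k. k \<in> K \<Longrightarrow> 0 < \<mu> k"
    and "op_trace (multi_indices n d) (weighted_ketbras K \<mu> z) = 1"
  shows "weighted_ketbras K \<mu> z \<in> sep_states n d"
proof -
  have cs: "\<And>k. k \<in> K \<Longrightarrow> z k \<in> coord_space (multi_indices n d)"
    using assms(3) by (rule product_vector_coord_space)
  have "weighted_ketbras K \<mu> z \<noteq> (\<lambda>_ _. 0)"
    using assms(5) by (auto simp: op_trace_def)
  moreover have "positive_semidefinite (multi_indices n d) (weighted_ketbras K \<mu> z)"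
    using cs assms(4) by (intro weighted_ketbras_psd) (auto intro: less_imp_le)
  moreover have "weighted_ketbras K \<mu> z \<in> trace_one_hyperplane n d"
    unfolding trace_one_hyperplane_def using assms(5) weighted_ketbras_hermitian[of K z, OF cs] by blast
  ultimately show ?thesis
    using weighted_product_decomposition[of K n d z \<mu>] assms
    by (auto simp: sep_states_def separable_state_def is_state_def)
qed

section \<open>Caratheodory's bound on the length\<close>

lemma exists_nontrivial_relation:
  fixes M :: "'j \<Rightarrow> 'l \<Rightarrow> 'a::field"
  assumes "finite J" "finite L" "card J < card L"
  shows "\<exists>\<mu>. (\<exists>l\<in>L. \<mu> l \<noteq> 0) \<and> (\<forall>j\<in>J. (\<Sum>l\<in>L. M j l * \<mu> l) = 0)"
  using assms
proof (induction J arbitrary: L M rule: finite_induct)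
  case empty
  then obtain l where "l \<in> L" by fastforce
  then show ?case by (intro exI[of _ "\<lambda>_. 1"]) auto
next
  case (insert j J)
  show ?case
  proof (cases "\<forall>l\<in>L. M j l = 0")
    case True
    have "card J < card L" using insert by simp
    from insert.IH[OF insert.prems(1) this, of M] True show ?thesis by auto
  next
    case False
    then obtain p where p: "p \<in> L" "M j p \<noteq> 0" by blast
    \<comment> \<open>Gaussian elimination: equation \<open>j\<close> with pivot \<open>p\<close>
      removes one equation and one unknown, so the unknowns still outnumber the equations.\<close>
    define L' where "L' = L - {p}"
    have L': "finite L'" "card J < card L'"
      using insert p by (auto simp: L'_def)
    from insert.IH[OF L', of "\<lambda>i l. M i l - M i p * M j l / M j p"]
    obtain \<mu> where \<mu>: "\<exists>l\<in>L'. \<mu> l \<noteq> 0"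
      "\<forall>i\<in>J. (\<Sum>l\<in>L'. (M i l - M i p * M j l / M j p) * \<mu> l) = 0"
      by blast
    \<comment> \<open>The value at \<open>p\<close> solves equation \<open>j\<close>. Substituting
      it gives the reduced coefficients in every row; in row \<open>j\<close> itself they
      vanish.\<close>
    define \<nu> where "\<nu> = \<mu>(p := - (\<Sum>l\<in>L'. M j l * \<mu> l) / M j p)"
    have eq: "(\<Sum>l\<in>L. M i l * \<nu> l) = (\<Sum>l\<in>L'. (M i l - M i p * M j l / M j p) * \<mu> l)" for i
    proof -
      have "(\<Sum>l\<in>L. M i l * \<nu> l) = M i p * \<nu> p + (\<Sum>l\<in>L'. M i l * \<nu> l)"
        unfolding L'_def using insert.prems(1) p(1) by (rule sum.remove)
      also have "(\<Sum>l\<in>L'. M i l * \<nu> l) = (\<Sum>l\<in>L'. M i l * \<mu> l)"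
        by (intro sum.cong) (auto simp: L'_def \<nu>_def)
      also have "M i p * \<nu> p = - (\<Sum>l\<in>L'. M i p * M j l / M j p * \<mu> l)"
        by (simp add: \<nu>_def sum_distrib_left sum_divide_distrib mult_ac)
      finally show ?thesis
        by (simp add: left_diff_distrib sum_subtractf)
    qed
    have "\<forall>i\<in>insert j J. (\<Sum>l\<in>L. M i l * \<nu> l) = 0"
      unfolding eq using \<mu>(2) p(2) by simp
    moreover have "\<exists>l\<in>L. \<nu> l \<noteq> 0"
      using \<mu>(1) by (auto simp: L'_def \<nu>_def)
    ultimately show ?thesis by blast
  qed
qed

text \<open>Caratheodory's step for cones. The projectors are determined by
  \<open>(total_dim n d)\<^sup>2\<close> real coordinates, so a longer sum admits a linear relation
  among its terms; shifting the weights along it removes a term.\<close>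

lemma product_decomposition_reduce:
  assumes dec: "product_decomposition n d \<rho> l z" and "(total_dim n d)\<^sup>2 < l" "0 < n"
  shows "\<exists>l'<l. \<exists>z'. product_decomposition n d \<rho> l' z'"
proof -
  define I where "I = multi_indices n d"
  have pv: "\<And>k. k < l \<Longrightarrow> product_vector n d (z k)"
    using dec by (simp add: product_decomposition_def)
  then have cs: "\<And>k. k \<in> {..<l} \<Longrightarrow> z k \<in> coord_space I"
    unfolding I_def by (simp add: product_vector_coord_space)
  have "card (I \<times> I) < card {..<l}"
    using assms(2) by (simp add: I_def card_cartesian_product card_multi_indices power2_eq_square)
  then obtain \<mu> :: "nat \<Rightarrow> real" where \<mu>: "\<exists>k\<in>{..<l}. \<mu> k \<noteq> 0"
    "\<forall>ij\<in>I \<times> I. (\<Sum>k<l. herm_coord (ketbra (z k)) ij * \<mu> k) = 0"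
    using exists_nontrivial_relation[of "I \<times> I" "{..<l}" "\<lambda>ij k. herm_coord (ketbra (z k)) ij"]
    by (auto simp: I_def finite_multi_indices)
  \<comment> \<open>A change of sign, if necessary, gives the relation a positive
    coefficient.\<close>
  define \<nu> where "\<nu> = (if \<exists>k<l. 0 < \<mu> k then \<mu> else (\<lambda>k. - \<mu> k))"
  have pos: "\<exists>k<l. 0 < \<nu> k"
    using \<mu>(1) by (auto simp: \<nu>_def) (meson linorder_neqE_linordered_idom)
  have rel: "\<forall>ij\<in>I \<times> I. (\<Sum>k<l. \<nu> k * herm_coord (ketbra (z k)) ij) = 0"
    using \<mu>(2) by (auto simp: \<nu>_def mult.commute sum_negf)
  obtain p where p: "p < l" "\<And>k. k < l \<Longrightarrow> \<nu> k \<le> \<nu> p"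
  proof -
    have "Max (\<nu> ` {..<l}) \<in> \<nu> ` {..<l}"
      using pos by (intro Max_in) auto
    then obtain p where "p < l" "\<nu> p = Max (\<nu> ` {..<l})" by auto
    then show thesis by (intro that[of p]) auto
  qed
  have "0 < \<nu> p" using pos p(2) by (meson less_le_trans)
  \<comment> \<open>Since \<open>\<nu> p\<close> is the largest coefficient and positive, all
    weights stay nonnegative and the weight of \<open>p\<close> becomes zero.\<close>
  define \<sigma> where "\<sigma> k = 1 - \<nu> k / \<nu> p" for k
  define K where "K = {k. k < l \<and> 0 < \<sigma> k}"
  have \<sigma>: "0 \<le> \<sigma> k" if "k < l" for k
    using p(2)[OF that] \<open>0 < \<nu> p\<close> by (simp add: \<sigma>_def)
  have "p \<notin> K" using \<open>0 < \<nu> p\<close> by (simp add: K_def \<sigma>_def)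
  then have "K \<subset> {..<l}" using p(1) by (auto simp: K_def)
  then have "card K < l" by (metis psubset_card_mono finite_lessThan card_lessThan)
  moreover have "\<rho> = weighted_ketbras K \<sigma> z"
  proof -
    have "\<rho> = weighted_ketbras {..<l} (\<lambda>_. 1) z"
      using dec by (rule product_decomposition_weighted)
    also have "\<dots> = weighted_ketbras {..<l} \<sigma> z"
    proof (rule hermitian_eqI[OF weighted_ketbras_hermitian weighted_ketbras_hermitian])
      fix i j assume "i \<in> I" "j \<in> I"
      then have "(\<Sum>k<l. \<nu> k * herm_coord (ketbra (z k)) (i, j)) / \<nu> p = 0"
        using rel by simp
      then show "herm_coord (weighted_ketbras {..<l} (\<lambda>_. 1) z) (i, j) =
          herm_coord (weighted_ketbras {..<l} \<sigma> z) (i, j)"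
        by (simp add: herm_coord_weighted_ketbras \<sigma>_def left_diff_distrib sum_subtractf sum_divide_distrib)
    qed (use cs in auto)
    also have "\<dots> = weighted_ketbras K \<sigma> z"
      unfolding weighted_ketbras_def
    proof (intro ext sum.mono_neutral_right)
      show "\<forall>k\<in>{..<l} - K. complex_of_real (\<sigma> k) * ketbra (z k) a b = 0" for a b
        using \<sigma> by (auto simp: K_def not_less intro: antisym)
    qed (auto simp: K_def)
    finally show ?thesis .
  qed
  moreover have "\<exists>z'. product_decomposition n d (weighted_ketbras K \<sigma> z) (card K) z'"
    using pv \<open>0 < n\<close> by (intro weighted_product_decomposition) (auto simp: K_def)
  ultimately show ?thesis by auto
qed

lemma state_length_decomposition:
  assumes "separable_state n d \<rho>"
  shows "\<exists>z. product_decomposition n d \<rho> (state_length n d \<rho>) z"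
proof -
  obtain l where "\<exists>z. product_decomposition n d \<rho> l z"
    using assms by (auto simp: separable_state_def)
  then show ?thesis
    unfolding state_length_def by (rule LeastI[where P = "\<lambda>l. \<exists>z. product_decomposition n d \<rho> l z"])
qed

lemma state_length_le:
  assumes "separable_state n d \<rho>" "0 < n"
  shows "state_length n d \<rho> \<le> (total_dim n d)\<^sup>2"
proof (rule ccontr)
  assume "\<not> ?thesis"
  then obtain l z where "l < state_length n d \<rho>" "product_decomposition n d \<rho> l z"
    using state_length_decomposition[OF assms(1)] product_decomposition_reduce assms(2)
    by (metis not_le)
  then show False
    unfolding state_length_def using not_less_Least by blast
qed

lemma sep_states_le_total_dim_squared:
  assumes "0 < n"
  shows "sep_states_le n d ((total_dim n d)\<^sup>2) = sep_states n d"
  using state_length_le assms by (auto simp: sep_states_le_def sep_states_def)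

section \<open>Charts of the states of bounded length\<close>

definition complex_poly :: "'p set \<Rightarrow> (('p \<Rightarrow> real) \<Rightarrow> complex) \<Rightarrow> bool" where
  "complex_poly P g \<longleftrightarrow> (\<lambda>t. Re (g t)) \<in> poly_functions P \<and> (\<lambda>t. Im (g t)) \<in> poly_functions P"

lemma complex_poly_const: "complex_poly P (\<lambda>_. c)"
  by (simp add: complex_poly_def poly_functions.const)

lemma complex_poly_of_real: "f \<in> poly_functions P \<Longrightarrow> complex_poly P (\<lambda>t. of_real (f t))"
  by (simp add: complex_poly_def poly_functions.const)

lemma complex_poly_Complex:
  "f \<in> poly_functions P \<Longrightarrow> g \<in> poly_functions P \<Longrightarrow> complex_poly P (\<lambda>t. Complex (f t) (g t))"
  by (simp add: complex_poly_def)

lemma complex_poly_cnj: "complex_poly P g \<Longrightarrow> complex_poly P (\<lambda>t. cnj (g t))"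
  by (simp add: complex_poly_def poly_functions_minus)

lemma complex_poly_mult:
  "complex_poly P g \<Longrightarrow> complex_poly P h \<Longrightarrow> complex_poly P (\<lambda>t. g t * h t)"
  by (auto simp: complex_poly_def intro!: poly_functions_diff poly_functions.add poly_functions.mult)

lemma complex_poly_sum:
  "(\<And>i. i \<in> A \<Longrightarrow> complex_poly P (g i)) \<Longrightarrow> complex_poly P (\<lambda>t. \<Sum>i\<in>A. g i t)"
  by (simp add: complex_poly_def poly_functions_sum)

lemma complex_poly_prod:
  "(\<And>i. i \<in> A \<Longrightarrow> complex_poly P (g i)) \<Longrightarrow> complex_poly P (\<lambda>t. \<Prod>i\<in>A. g i t)"
  by (induction A rule: infinite_finite_induct) (auto intro: complex_poly_mult complex_poly_const)

text \<open>In the chart \<open>c\<close> the \<open>i\<close>-th factor of the \<open>k\<close>-th product vector has the entry \<open>1\<close> at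
  \<open>c k i\<close>. The parameters of the remaining entries are indexed by \<open>{1..<d i}\<close>; the entry at \<open>0\<close>
  takes the place of the missing one.\<close>

definition sep_params :: "nat \<Rightarrow> (nat \<Rightarrow> nat) \<Rightarrow> nat \<Rightarrow> (nat \<times> (nat \<times> nat \<times> bool) option) set" where
  "sep_params n d r =
     {..<r} \<times> insert None (Some ` (SIGMA i:{..<n}. {1..<d i} \<times> UNIV))"

definition sep_charts :: "nat \<Rightarrow> (nat \<Rightarrow> nat) \<Rightarrow> nat \<Rightarrow> (nat \<Rightarrow> nat \<Rightarrow> nat) set" where
  "sep_charts n d r = (\<Pi>\<^sub>E k\<in>{..<r}. multi_indices n d)"

definition chart_entry ::
    "(nat \<Rightarrow> nat \<Rightarrow> nat) \<Rightarrow> (nat \<times> (nat \<times> nat \<times> bool) option \<Rightarrow> real) \<Rightarrow> nat \<Rightarrow> nat \<Rightarrow> nat \<Rightarrow> complex" where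
  "chart_entry c t k i j =
     (if j = c k i then 1
      else let j' = (if j = 0 then c k i else j)
           in Complex (t (k, Some (i, j', False))) (t (k, Some (i, j', True))))"

text \<open>The vectors are not cut off outside the multi-indices, and the weights may have any
  sign: the charts only have to cover the cone, and are compared with it on multi-indices.\<close>

definition chart_operator ::
    "nat \<Rightarrow> nat \<Rightarrow> (nat \<Rightarrow> nat \<Rightarrow> nat) \<Rightarrow> (nat \<times> (nat \<times> nat \<times> bool) option \<Rightarrow> real) \<Rightarrow> multi_operator" where
  "chart_operator n r c t =
     weighted_ketbras {..<r} (\<lambda>k. t (k, None)) (\<lambda>k a. \<Prod>i<n. chart_entry c t k i (a i))"

lemma finite_sep_params: "finite (sep_params n d r)"
  by (simp add: sep_params_def)

lemma finite_sep_charts: "finite (sep_charts n d r)"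
  by (simp add: sep_charts_def finite_PiE finite_multi_indices)

lemma card_sep_params: "card (sep_params n d r) = r * product_params n d"
proof -
  have "card (SIGMA i:{..<n}. {1..<d i} \<times> (UNIV :: bool set)) = (\<Sum>i<n. 2 * (d i - 1))"
    by (simp add: card_cartesian_product mult.commute)
  moreover have "None \<notin> Some ` (SIGMA i:{..<n}. {1..<d i} \<times> (UNIV :: bool set))"
    by blast
  ultimately show ?thesis
    by (simp add: sep_params_def card_cartesian_product card_image product_params_def sum_distrib_left)
qed

lemma chart_operator_poly:
  assumes c: "c \<in> sep_charts n d r" and ab: "a \<in> multi_indices n d" "b \<in> multi_indices n d"
  shows "(\<lambda>t. herm_coord (chart_operator n r c t) (a, b)) \<in> poly_functions (sep_params n d r)"
proof -
  let ?P = "sep_params n d r"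
  have entry: "complex_poly ?P (\<lambda>t. chart_entry c t k i j)" if "k < r" "i < n" "j < d i" for k i j
  proof (cases "j = c k i")
    case True
    then show ?thesis by (simp add: chart_entry_def complex_poly_const)
  next
    case False
    define j' where "j' = (if j = 0 then c k i else j)"
    have "c k \<in> multi_indices n d" using c that by (auto simp: sep_charts_def)
    then have "c k i < d i" using that by (auto simp: multi_indices_def)
    \<comment> \<open>If \<open>j = 0\<close> then \<open>c k i\<close> is nonzero, because it
      differs from \<open>j\<close>; so the substituted index avoids 0.\<close>
    then have "j' \<in> {1..<d i}" using False that by (auto simp: j'_def)
    then have "(k, Some (i, j', b)) \<in> ?P" for b
      using that by (simp add: sep_params_def)
    then show ?thesis
      using False unfolding chart_entry_def Let_def j'_def[symmetric]
      by (auto intro!: complex_poly_Complex poly_functions.coord)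
  qed
  have "complex_poly ?P (\<lambda>t. \<Prod>i<n. chart_entry c t k i (a i))"
    if "k < r" "a \<in> multi_indices n d" for k a
    using that by (intro complex_poly_prod entry) (auto simp: multi_indices_def)
  moreover have "(\<lambda>t. t (k, None)) \<in> poly_functions ?P" if "k < r" for k
    using that by (intro poly_functions.coord) (simp add: sep_params_def)
  ultimately have "complex_poly ?P (\<lambda>t. chart_operator n r c t a b)"
    unfolding chart_operator_def weighted_ketbras_def ketbra_def using ab
    by (intro complex_poly_sum complex_poly_mult complex_poly_cnj complex_poly_of_real) auto
  then show ?thesis
    by (simp add: herm_coord_def complex_poly_def poly_functions.add)
qed

text \<open>Each factor is divided by its entry of largest modulus, nonzero because the product
  vector is nonzero. This choice, and not just any nonzero entry, confines the others to the unit
  disc.\<close>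

lemma product_vector_normal_form:
  assumes "product_vector n d z"
  obtains \<kappa> c y where "c \<in> multi_indices n d" "\<And>i. i < n \<Longrightarrow> y i (c i) = 1"
    "\<And>i j. i < n \<Longrightarrow> j < d i \<Longrightarrow> cmod (y i j) \<le> 1"
    "\<And>a. a \<in> multi_indices n d \<Longrightarrow> z a = \<kappa> * (\<Prod>i<n. y i (a i))"
proof -
  obtain x where x: "z = tensor_vec n d x" and "z \<noteq> (\<lambda>_. 0)"
    using assms by (auto simp: product_vector_def)
  then obtain a0 where "z a0 \<noteq> 0" by auto
  then have a0: "a0 \<in> multi_indices n d" "(\<Prod>i<n. x i (a0 i)) \<noteq> 0"
    by (auto simp: x tensor_vec_def split: if_splits)
  have "\<exists>m<d i. x i m \<noteq> 0 \<and> (\<forall>j<d i. cmod (x i j) \<le> cmod (x i m))" if "i < n" for i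
  proof -
    have ai: "a0 i < d i" "x i (a0 i) \<noteq> 0"
      using a0 that by (auto simp: multi_indices_def)
    let ?S = "(\<lambda>j. cmod (x i j)) ` {..<d i}"
    have "Max ?S \<in> ?S" using ai by (intro Max_in) auto
    then obtain m where m: "m < d i" "cmod (x i m) = Max ?S" by auto
    then have max: "\<forall>j<d i. cmod (x i j) \<le> cmod (x i m)" by auto
    then have "x i m \<noteq> 0" using ai by fastforce
    with m max show ?thesis by blast
  qed
  then obtain c where c: "\<And>i. i < n \<Longrightarrow> c i < d i" "\<And>i. i < n \<Longrightarrow> x i (c i) \<noteq> 0"
    "\<And>i j. i < n \<Longrightarrow> j < d i \<Longrightarrow> cmod (x i j) \<le> cmod (x i (c i))"
    by metis
  show thesis
  proof (rule that)
    show "restrict c {..<n} \<in> multi_indices n d"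
      using c by (auto simp: multi_indices_def)
    show "x i (restrict c {..<n} i) / x i (c i) = 1" if "i < n" for i
      using c(2)[OF that] that by simp
    show "cmod (x i j / x i (c i)) \<le> 1" if "i < n" "j < d i" for i j
      using c(2,3)[of i] that by (simp add: norm_divide)
    show "z a = (\<Prod>i<n. x i (c i)) * (\<Prod>i<n. x i (a i) / x i (c i))" if "a \<in> multi_indices n d" for a
    proof -
      have "(\<Prod>i<n. x i (c i)) \<noteq> 0" using c(2) by simp
      then show ?thesis using that by (simp add: x tensor_vec_def prod_dividef)
    qed
  qed
qed

lemma sep_states_le_decomposition:
  assumes "\<rho> \<in> sep_states_le n d r"
  obtains l z where "l \<le> r" "product_decomposition n d \<rho> l z"
proof -
  have "separable_state n d \<rho>" "state_length n d \<rho> \<le> r"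
    using assms by (auto simp: sep_states_le_def sep_states_def)
  then show thesis
    using state_length_decomposition that by blast
qed

lemma weight_le_trace:
  assumes "finite K" "k \<in> K" "finite I" "a \<in> I" "op_trace I (weighted_ketbras K (\<lambda>_. 1) z) = 1"
  shows "(cmod (z k a))\<^sup>2 \<le> 1"
proof -
  have "(cmod (z k a))\<^sup>2 \<le> (\<Sum>a\<in>I. (cmod (z k a))\<^sup>2)"
    using assms by (intro member_le_sum) auto
  also have "\<dots> \<le> (\<Sum>k\<in>K. \<Sum>a\<in>I. (cmod (z k a))\<^sup>2)"
    using assms by (intro member_le_sum[of k K "\<lambda>k. \<Sum>a\<in>I. (cmod (z k a))\<^sup>2"]) (auto intro: sum_nonneg)
  also have "\<dots> = 1"
    using assms(5) by (simp add: op_trace_weighted_ketbras flip: of_real_sum)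
  finally show ?thesis .
qed

text \<open>The scale \<open>s\<close> and the constants of the normal forms go into the weights. A
  state of length below \<open>r\<close> is padded with terms of weight 0.\<close>

lemma cone_over_sep_states_le_in_charts:
  assumes d: "\<And>i. i < n \<Longrightarrow> 0 < d i"
    and \<rho>: "\<rho> \<in> sep_states_le n d r" and s: "0 < s" "s \<le> 1"
  shows "\<exists>c\<in>sep_charts n d r. \<exists>t. (\<forall>p\<in>sep_params n d r. \<bar>t p\<bar> \<le> 1) \<and>
    (\<forall>ab\<in>multi_indices n d \<times> multi_indices n d.
      s * herm_coord \<rho> ab = herm_coord (chart_operator n r c t) ab)"
proof -
  define I where "I = multi_indices n d"
  obtain l z where lz: "l \<le> r" "product_decomposition n d \<rho> l z"
    using sep_states_le_decomposition[OF \<rho>] by blast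
  have "\<forall>k\<in>{..<l}. \<exists>\<kappa> c y. c \<in> I \<and> (\<forall>i<n. y i (c i) = 1) \<and>
      (\<forall>i<n. \<forall>j<d i. cmod (y i j) \<le> 1) \<and> (\<forall>a\<in>I. z k a = \<kappa> * (\<Prod>i<n. y i (a i)))"
  proof
    fix k assume "k \<in> {..<l}"
    then have "product_vector n d (z k)" using lz(2) by (simp add: product_decomposition_def)
    then obtain \<kappa> c y where "c \<in> I" "\<And>i. i < n \<Longrightarrow> y i (c i) = 1"
      "\<And>i j. i < n \<Longrightarrow> j < d i \<Longrightarrow> cmod (y i j) \<le> 1"
      "\<And>a. a \<in> I \<Longrightarrow> z k a = \<kappa> * (\<Prod>i<n. y i (a i))"
      unfolding I_def by (rule product_vector_normal_form) blast
    then show "\<exists>\<kappa> c y. c \<in> I \<and> (\<forall>i<n. y i (c i) = 1) \<and>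
      (\<forall>i<n. \<forall>j<d i. cmod (y i j) \<le> 1) \<and> (\<forall>a\<in>I. z k a = \<kappa> * (\<Prod>i<n. y i (a i)))"
      by blast
  qed
  from bchoice[OF this] obtain \<kappa> where "\<forall>k\<in>{..<l}. \<exists>c y. c \<in> I \<and> (\<forall>i<n. y i (c i) = 1) \<and>
      (\<forall>i<n. \<forall>j<d i. cmod (y i j) \<le> 1) \<and> (\<forall>a\<in>I. z k a = \<kappa> k * (\<Prod>i<n. y i (a i)))" ..
  from bchoice[OF this] obtain c where "\<forall>k\<in>{..<l}. \<exists>y. c k \<in> I \<and> (\<forall>i<n. y i (c k i) = 1) \<and>
      (\<forall>i<n. \<forall>j<d i. cmod (y i j) \<le> 1) \<and> (\<forall>a\<in>I. z k a = \<kappa> k * (\<Prod>i<n. y i (a i)))" ..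
  from bchoice[OF this] obtain y where ky: "\<forall>k\<in>{..<l}. c k \<in> I \<and> (\<forall>i<n. y k i (c k i) = 1) \<and>
      (\<forall>i<n. \<forall>j<d i. cmod (y k i j) \<le> 1) \<and> (\<forall>a\<in>I. z k a = \<kappa> k * (\<Prod>i<n. y k i (a i)))" ..
  have c: "c k \<in> I"
    and y1: "\<And>i. i < n \<Longrightarrow> y k i (c k i) = 1"
    and y: "\<And>i j. i < n \<Longrightarrow> j < d i \<Longrightarrow> cmod (y k i j) \<le> 1"
    and z: "\<And>a. a \<in> I \<Longrightarrow> z k a = \<kappa> k * (\<Prod>i<n. y k i (a i))" if "k < l" for k
    using ky that by blast+
  \<comment> \<open>The chart index for the padding terms; it is a multi-index because every
    \<open>d i\<close> is positive.\<close>
  define e where "e = (\<lambda>i\<in>{..<n}. 0::nat)"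
  have "e \<in> I" using d by (auto simp: e_def I_def multi_indices_def)
  define c' where "c' = (\<lambda>k\<in>{..<r}. if k < l then c k else e)"
  \<comment> \<open>The swap of the indices 0 and \<open>c k i\<close> inverts the one in
    \<open>chart_entry\<close>: the slot of the normalised entry stores the entry at 0.\<close>
  define t where "t = (\<lambda>(k, q). if k < l then
      (case q of None \<Rightarrow> s * (cmod (\<kappa> k))\<^sup>2
       | Some (i, j, b) \<Rightarrow> (if b then Im else Re) (y k i (if j = c k i then 0 else j))) else 0)"
  have c': "c' \<in> sep_charts n d r"
    using c \<open>e \<in> I\<close> by (auto simp: c'_def sep_charts_def I_def)
  \<comment> \<open>At the multi-index \<open>c k\<close> the normalised product is 1, so
    \<open>\<kappa> k\<close> is an entry of \<open>z k\<close>; the trace is the sum of the squared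
    moduli of all entries.\<close>
  have \<kappa>: "(cmod (\<kappa> k))\<^sup>2 \<le> 1" if "k < l" for k
  proof -
    have "\<rho> \<in> hyperplane I"
      using \<rho> by (simp add: sep_states_le_def sep_states_def I_def trace_one_hyperplane_eq)
    then have "op_trace I (weighted_ketbras {..<l} (\<lambda>_. 1) z) = 1"
      using product_decomposition_weighted[OF lz(2)] by (simp add: hyperplane_def)
    then have "(cmod (z k (c k)))\<^sup>2 \<le> 1"
      using that c[OF that] by (intro weight_le_trace[of "{..<l}" k I "c k" z]) (auto simp: I_def finite_multi_indices)
    then show ?thesis using z[OF that c[OF that]] y1[OF that] by simp
  qed
  have entry: "chart_entry c' t k i j = y k i j" if "k < l" "i < n" for k i j
    using that y1[OF that] lz(1)
    by (auto simp: chart_entry_def c'_def t_def Let_def complex_eq_iff)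
  have "\<bar>t p\<bar> \<le> 1" if p: "p \<in> sep_params n d r" for p
  proof -
    obtain k q where kq: "p = (k, q)" by (cases p)
    show ?thesis
    proof (cases "k < l")
      case k: True
      show ?thesis
      proof (cases q)
        case None
        have "s * (cmod (\<kappa> k))\<^sup>2 \<le> 1 * 1"
          using \<kappa>[OF k] s by (intro mult_mono) auto
        then show ?thesis using k s None by (simp add: kq t_def)
      next
        case (Some w)
        then obtain i j b where w: "q = Some (i, j, b)" by (cases w) auto
        have ij: "i < n" "j < d i" "0 < d i" using p d by (auto simp: kq w sep_params_def)
        define j' where "j' = (if j = c k i then 0 else j)"
        have "j' < d i" using ij by (simp add: j'_def)
        then have "cmod (y k i j') \<le> 1" using y k ij by blast
        then have "\<bar>Re (y k i j')\<bar> \<le> 1" "\<bar>Im (y k i j')\<bar> \<le> 1"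
          using abs_Re_le_cmod abs_Im_le_cmod order_trans by blast+
        then show ?thesis using k by (simp add: kq w t_def j'_def)
      qed
    qed (simp add: kq t_def)
  qed
  moreover have "s * herm_coord \<rho> ab = herm_coord (chart_operator n r c' t) ab" if abI: "ab \<in> I \<times> I" for ab
  proof -
    obtain a b where ab: "ab = (a, b)" "a \<in> I" "b \<in> I" using abI by blast
    have "herm_coord (chart_operator n r c' t) ab =
        (\<Sum>k<r. t (k, None) * herm_coord (ketbra (\<lambda>a. \<Prod>i<n. chart_entry c' t k i (a i))) ab)"
      by (simp add: chart_operator_def herm_coord_weighted_ketbras)
    also have "\<dots> = (\<Sum>k<l. t (k, None) * herm_coord (ketbra (\<lambda>a. \<Prod>i<n. chart_entry c' t k i (a i))) ab)"
      using lz(1) by (intro sum.mono_neutral_right) (auto simp: t_def)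
    also have "\<dots> = (\<Sum>k<l. s * herm_coord (ketbra (z k)) ab)"
    proof (rule sum.cong[OF refl])
      fix k assume "k \<in> {..<l}"
      then have k: "k < l" by simp
      let ?y = "\<lambda>a. \<Prod>i<n. y k i (a i)"
      have "ketbra (z k) a b = ketbra (\<lambda>a. \<kappa> k * ?y a) a b"
        using z[OF k] ab by (simp add: ketbra_def)
      then have "ketbra (z k) a b = of_real ((cmod (\<kappa> k))\<^sup>2) * ketbra ?y a b"
        by (simp only: ketbra_scale)
      moreover have "ketbra (\<lambda>a. \<Prod>i<n. chart_entry c' t k i (a i)) = ketbra ?y"
        using entry[OF k] by simp
      ultimately show "t (k, None) * herm_coord (ketbra (\<lambda>a. \<Prod>i<n. chart_entry c' t k i (a i))) ab =
          s * herm_coord (ketbra (z k)) ab"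
        using k by (simp add: t_def herm_coord_def ab(1) distrib_left)
    qed
    also have "\<dots> = s * herm_coord \<rho> ab"
      using product_decomposition_weighted[OF lz(2)]
      by (simp add: herm_coord_weighted_ketbras flip: sum_distrib_left)
    finally show ?thesis by simp
  qed
  ultimately show ?thesis using c' unfolding I_def by blast
qed

section \<open>A full-dimensional simplex of separable states\<close>

text \<open>The projectors onto \<open>e\<^sub>p + (1 + \<i>) e\<^sub>q\<close> form a basis of the operators. No ordering of the
  indices is needed to distinguish the roles of \<open>p\<close> and \<open>q\<close>, because \<open>(1 + \<i>)\<^sup>2\<close> is not real.\<close>

definition basis_vec :: "nat \<Rightarrow> nat \<Rightarrow> nat \<Rightarrow> complex" where
  "basis_vec p q j = (if j = p then 1 else 0) + (if j = q then 1 + \<i> else 0)"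

text \<open>The functional sending \<open>M\<close> to
  \<open>((1 + \<i>) * M p q + (1 - \<i>) * M q p) / 4\<close>. On the projector for
  \<open>(p, q)\<close> both products equal 2, giving 1; for \<open>(q, p)\<close> they are the
  squares of \<open>1 + \<i>\<close> and \<open>1 - \<i>\<close>, which cancel.\<close>

definition off_diag_dual :: "nat \<Rightarrow> nat \<Rightarrow> nat \<Rightarrow> nat \<Rightarrow> complex" where
  "off_diag_dual p q a b =
     (if a = p then if b = q then (1 + \<i>) / 4 else 0 else 0) +
     (if a = q then if b = p then (1 - \<i>) / 4 else 0 else 0)"

text \<open>The entry \<open>M p p\<close> of a basis projector is 5 for \<open>(p, p)\<close>,
  since the vector is \<open>2 + \<i>\<close> there, 1 for \<open>(p, r)\<close> and 2 for
  \<open>(r, p)\<close>. The off-diagonal contributions are subtracted with these weights before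
  dividing by 5.\<close>

definition basis_dual :: "nat \<Rightarrow> nat \<Rightarrow> nat \<Rightarrow> nat \<Rightarrow> nat \<Rightarrow> complex" where
  "basis_dual m p q a b =
     (if p = q
      then ((if a = p then if b = p then 1 else 0 else 0) -
            (\<Sum>r\<in>{..<m} - {p}. off_diag_dual p r a b + 2 * off_diag_dual r p a b)) / 5
      else off_diag_dual p q a b)"

lemma sum_off_diag_dual:
  assumes "p < m" "q < m"
  shows "(\<Sum>a<m. \<Sum>b<m. off_diag_dual p q a b * M a b) = ((1 + \<i>) * M p q + (1 - \<i>) * M q p) / 4"
proof -
  have if_mult: "(if P then x else 0) * y = (if P then x * y else 0)" for P and x y :: complex
    by simp
  have if_sum: "(\<Sum>b<m. if P then f b else 0) = (if P then \<Sum>b<m. f b else 0)"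
    for P and f :: "nat \<Rightarrow> complex"
    by simp
  show ?thesis
    using assms
    by (simp add: off_diag_dual_def distrib_right sum.distrib if_mult if_sum add_divide_distrib)
qed

lemma off_diag_dual_ketbra:
  assumes "p < m" "q < m" "p \<noteq> q"
  shows "(\<Sum>a<m. \<Sum>b<m. off_diag_dual p q a b * ketbra (basis_vec p' q') a b) =
    (if p = p' then if q = q' then 1 else 0 else 0)"
proof -
  have *: "((1 + \<i>) * ketbra (basis_vec p' q') p q + (1 - \<i>) * ketbra (basis_vec p' q') q p) / 4 =
      (if p = p' then if q = q' then 1 else 0 else 0)"
    using assms(3) unfolding ketbra_def basis_vec_def
    by (cases "p = p'"; cases "q = q'"; cases "p = q'"; cases "q = p'") (simp_all add: complex_eq_iff)
  show ?thesis
    unfolding sum_off_diag_dual[OF assms(1,2)] by (rule *)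
qed

lemma basis_dual_ketbra:
  assumes "p < m" "q < m" "p' < m" "q' < m"
  shows "(\<Sum>a<m. \<Sum>b<m. basis_dual m p q a b * ketbra (basis_vec p' q') a b) =
    (if p = p' \<and> q = q' then 1 else 0)"
proof (cases "p = q")
  case False
  then show ?thesis
    using off_diag_dual_ketbra[OF assms(1,2), of p' q'] by (auto simp: basis_dual_def)
next
  case True
  define M where "M = ketbra (basis_vec p' q')"
  define R where "R = {..<m} - {p}"
  let ?L = "\<lambda>D. \<Sum>a<m. \<Sum>b<m. D a b * M a b"
  have "?L (basis_dual m p q) = (\<Sum>a<m. \<Sum>b<m. ((if a = p then if b = p then M a b else 0 else 0) -
      (\<Sum>r\<in>R. off_diag_dual p r a b * M a b + 2 * (off_diag_dual r p a b * M a b))) / 5)"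
    using True by (intro sum.cong refl)
      (simp add: basis_dual_def R_def left_diff_distrib sum_distrib_right distrib_right mult.assoc)
  also have "\<dots> = ((\<Sum>a<m. \<Sum>b<m. if a = p then if b = p then M a b else 0 else 0) -
      (\<Sum>a<m. \<Sum>b<m. \<Sum>r\<in>R. off_diag_dual p r a b * M a b + 2 * (off_diag_dual r p a b * M a b))) / 5"
    by (simp add: sum_subtractf flip: sum_divide_distrib)
  also have "(\<Sum>a<m. \<Sum>b<m. if a = p then if b = p then M a b else 0 else 0) = (\<Sum>a<m. if a = p then M a p else 0)"
    using assms(1) by (intro sum.cong) auto
  also have "\<dots> = M p p" using assms(1) by simp
  also have "(\<Sum>a<m. \<Sum>b<m. \<Sum>r\<in>R. off_diag_dual p r a b * M a b + 2 * (off_diag_dual r p a b * M a b)) =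
      (\<Sum>a<m. \<Sum>r\<in>R. \<Sum>b<m. off_diag_dual p r a b * M a b + 2 * (off_diag_dual r p a b * M a b))"
    by (intro sum.cong refl sum.swap)
  also have "\<dots> = (\<Sum>r\<in>R. \<Sum>a<m. \<Sum>b<m. off_diag_dual p r a b * M a b + 2 * (off_diag_dual r p a b * M a b))"
    by (rule sum.swap)
  also have "\<dots> = (\<Sum>r\<in>R. ?L (off_diag_dual p r) + 2 * ?L (off_diag_dual r p))"
    by (simp add: sum.distrib sum_distrib_left)
  also have "\<dots> = (\<Sum>r\<in>R. (if p = p' then if r = q' then 1 else 0 else 0) +
      2 * (if r = p' then if p = q' then 1 else 0 else 0))"
  proof (rule sum.cong[OF refl])
    fix r assume "r \<in> R"
    then have r: "r < m" "r \<noteq> p" by (auto simp: R_def)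
    show "?L (off_diag_dual p r) + 2 * ?L (off_diag_dual r p) =
        (if p = p' then if r = q' then 1 else 0 else 0) + 2 * (if r = p' then if p = q' then 1 else 0 else 0)"
      unfolding M_def off_diag_dual_ketbra[OF assms(1) r(1) r(2)[symmetric]]
        off_diag_dual_ketbra[OF r(1) assms(1) r(2)] by simp
  qed
  also have "\<dots> = (if p = p' then \<Sum>r\<in>R. if r = q' then 1 else 0 else 0) +
      2 * (if p = q' then \<Sum>r\<in>R. if r = p' then 1 else 0 else 0)"
    by (simp add: sum.distrib flip: sum_distrib_left)
  also have "\<dots> = (if p = p' \<and> q' \<noteq> p then 1 else 0) + 2 * (if p = q' \<and> p' \<noteq> p then 1 else 0)"
  proof -
    have *: "(\<Sum>r\<in>R. if r = x then 1 else 0) = (if x \<noteq> p then 1 else 0 :: complex)" if "x < m" for x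
      using that by (simp add: R_def)
    show ?thesis
      unfolding *[OF assms(3)] *[OF assms(4)] by (cases "p = p'"; cases "p = q'") simp_all
  qed
  finally have "?L (basis_dual m p q) =
    (M p p - ((if p = p' \<and> q' \<noteq> p then 1 else 0) + 2 * (if p = q' \<and> p' \<noteq> p then 1 else 0))) / 5" .
  also have "\<dots> = (if p = p' \<and> q = q' then 1 else 0)"
    unfolding M_def ketbra_def basis_vec_def using True
    by (cases "p = p'"; cases "p = q'") (simp_all add: complex_eq_iff)
  finally show ?thesis by (simp add: M_def)
qed

section \<open>Tensor products of the dual bases\<close>

definition product_basis :: "nat \<Rightarrow> (nat \<Rightarrow> nat) \<Rightarrow> (nat \<Rightarrow> nat) \<times> (nat \<Rightarrow> nat) \<Rightarrow> (nat \<Rightarrow> nat) \<Rightarrow> complex" where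
  "product_basis n d pq = tensor_vec n d (\<lambda>i. basis_vec (fst pq i) (snd pq i))"

definition product_dual :: "nat \<Rightarrow> (nat \<Rightarrow> nat) \<Rightarrow> (nat \<Rightarrow> nat) \<times> (nat \<Rightarrow> nat) \<Rightarrow> multi_operator" where
  "product_dual n d pq a b = (\<Prod>i<n. basis_dual (d i) (fst pq i) (snd pq i) (a i) (b i))"

lemma prod_double_sum_multi_indices:
  fixes F :: "nat \<Rightarrow> nat \<Rightarrow> nat \<Rightarrow> complex"
  shows "(\<Sum>a\<in>multi_indices n d. \<Sum>b\<in>multi_indices n d. \<Prod>i<n. F i (a i) (b i)) =
    (\<Prod>i<n. \<Sum>a<d i. \<Sum>b<d i. F i a b)"
  by (simp add: multi_indices_def prod_sum_PiE)

lemma multi_indices_less: "a \<in> multi_indices n d \<Longrightarrow> i < n \<Longrightarrow> a i < d i"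
  by (auto simp: multi_indices_def)

lemma multi_indices_eqI:
  assumes "a \<in> multi_indices n d" "b \<in> multi_indices n d" "\<And>i. i < n \<Longrightarrow> a i = b i"
  shows "a = b"
  using assms unfolding multi_indices_def by (intro PiE_ext[of a "{..<n}" "\<lambda>i. {..<d i}" b]) simp_all

text \<open>The pairing of two tensor products factorises over the parties, leaving the duality of
  each single party.\<close>

lemma product_dual_ketbra:
  assumes pq: "pq \<in> multi_indices n d \<times> multi_indices n d" "pq' \<in> multi_indices n d \<times> multi_indices n d"
  shows "(\<Sum>a\<in>multi_indices n d. \<Sum>b\<in>multi_indices n d.
      product_dual n d pq a b * ketbra (product_basis n d pq') a b) = (if pq = pq' then 1 else 0)"
proof -
  let ?I = "multi_indices n d"
  have lt: "fst pq i < d i" "snd pq i < d i" "fst pq' i < d i" "snd pq' i < d i" if "i < n" for i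
    using pq multi_indices_less[OF _ that, of _ d] unfolding mem_Times_iff by blast+
  have "(\<Sum>a\<in>?I. \<Sum>b\<in>?I. product_dual n d pq a b * ketbra (product_basis n d pq') a b) =
      (\<Sum>a\<in>?I. \<Sum>b\<in>?I. \<Prod>i<n. basis_dual (d i) (fst pq i) (snd pq i) (a i) (b i) *
        ketbra (basis_vec (fst pq' i) (snd pq' i)) (a i) (b i))"
    by (intro sum.cong refl)
      (simp add: product_dual_def product_basis_def ketbra_def tensor_vec_def prod.distrib)
  also have "\<dots> = (\<Prod>i<n. if fst pq i = fst pq' i \<and> snd pq i = snd pq' i then 1 else 0)"
    using lt
    by (subst prod_double_sum_multi_indices[where F = "\<lambda>i a b. basis_dual (d i) (fst pq i) (snd pq i) a b *
          ketbra (basis_vec (fst pq' i) (snd pq' i)) a b"])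
      (intro prod.cong refl basis_dual_ketbra, simp_all)
  also have "\<dots> = (if pq = pq' then 1 else 0)"
  proof (cases "\<forall>i<n. fst pq i = fst pq' i \<and> snd pq i = snd pq' i")
    case True
    then have "fst pq = fst pq'" "snd pq = snd pq'"
      using pq unfolding mem_Times_iff by (meson multi_indices_eqI)+
    then have "pq = pq'" by (simp add: prod_eq_iff)
    with True show ?thesis by simp
  next
    case False
    then have "pq \<noteq> pq'" by auto
    with False show ?thesis by auto
  qed
  finally show ?thesis .
qed

text \<open>The vector is nonzero because its projector pairs to 1 with its own dual
  functional.\<close>

lemma product_vector_product_basis:
  assumes "pq \<in> multi_indices n d \<times> multi_indices n d"
  shows "product_vector n d (product_basis n d pq)"
proof -
  have "product_basis n d pq \<noteq> (\<lambda>_. 0)"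
  proof
    assume "product_basis n d pq = (\<lambda>_. 0)"
    then show False
      using product_dual_ketbra[OF assms assms] by (simp add: ketbra_def)
  qed
  moreover have "\<forall>i<n. basis_vec (fst pq i) (snd pq i) \<in> coord_space {..<d i}"
  proof (intro allI impI)
    fix i assume "i < n"
    then have "fst pq i < d i" "snd pq i < d i"
      using assms multi_indices_less unfolding mem_Times_iff by blast+
    then show "basis_vec (fst pq i) (snd pq i) \<in> coord_space {..<d i}"
      by (auto simp: basis_vec_def coord_space_def)
  qed
  ultimately show ?thesis
    unfolding product_vector_def
    by (intro conjI exI[of _ "\<lambda>i. basis_vec (fst pq i) (snd pq i)"]) (simp_all add: product_basis_def)
qed

lemma poly_functions_continuous: "p \<in> poly_functions J \<Longrightarrow> continuous_on S p"
proof (induction rule: poly_functions.induct)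
  case (coord j)
  show ?case by (rule continuous_on_subset[OF continuous_on_product_coordinates]) simp
next
  case (const c)
  show ?case by (rule continuous_on_const)
next
  case (add p q)
  then show ?case by (intro continuous_on_add)
next
  case (mult p q)
  then show ?case by (intro continuous_on_mult)
qed

text \<open>The simplex spanned by the normalized projectors onto the product basis is a full-dimensional
  cell of separable states; the dual basis recovers the barycentric coordinates.\<close>

lemma sep_states_full_cell:
  assumes "0 < n" and coords: "hyperplane_coords (multi_indices n d) i0 k e"
  defines "I \<equiv> multi_indices n d"
  shows "\<exists>C \<subseteq> real_coords ` sep_states n d. semialgebraic_cell (I \<times> I \<times> UNIV) k C"
proof -
  interpret hyperplane_coords I i0 k e using coords by (simp add: I_def)
  have e_in: "e q \<in> I \<times> I" "e q \<noteq> (i0, i0)" if "q < k" for q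
    using e that by (auto simp: bij_betw_def)
  define w where "w = product_basis n d"
  \<comment> \<open>The trace of the projector, by which the weights are divided to make the total
    trace equal to the sum of the barycentric coordinates.\<close>
  define \<tau> where "\<tau> pq = (\<Sum>a\<in>I. (cmod (w pq a))\<^sup>2)" for pq
  have pv: "product_vector n d (w pq)" if "pq \<in> I \<times> I" for pq
    using that unfolding w_def I_def by (rule product_vector_product_basis)
  have \<tau>: "0 < \<tau> pq" if pq: "pq \<in> I \<times> I" for pq
  proof -
    obtain a where a: "w pq a \<noteq> 0" using pv[OF pq] by (auto simp: product_vector_def)
    then have "a \<in> I"
      using product_vector_coord_space[OF pv[OF pq]] by (auto simp: coord_space_def I_def)
    with a show ?thesis
      unfolding \<tau>_def using fin by (intro sum_pos2[of I a]) auto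
  qed
  \<comment> \<open>One more than the number of coordinates: their sum over the cube, divided by
    \<open>N\<close>, stays below 1.\<close>
  define N where "N = real k + 1"
  \<comment> \<open>Barycentric coordinates: the vertex \<open>(i0, i0)\<close> receives the
    remainder, so that the cube maps into the interior of the simplex.\<close>
  define cf where "cf x pq = (if pq = (i0, i0) then 1 - (\<Sum>q<k. x q) / N else x (inv_into {..<k} e pq) / N)"
    for x :: "nat \<Rightarrow> real" and pq
  have cf_e: "cf x (e q) = x q / N" if "q < k" for x q
    using that e_in[OF that] e by (simp add: cf_def bij_betw_def)
  have cf_sum: "(\<Sum>pq\<in>I \<times> I. cf x pq) = 1" for x
  proof -
    have "(\<Sum>pq\<in>I \<times> I. cf x pq) = cf x (i0, i0) + (\<Sum>pq\<in>I \<times> I - {(i0, i0)}. cf x pq)"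
      using fin i0 by (intro sum.remove) auto
    also have "(\<Sum>pq\<in>I \<times> I - {(i0, i0)}. cf x pq) = (\<Sum>q<k. cf x (e q))"
      by (rule sum.reindex_bij_betw[OF e, symmetric])
    also have "\<dots> = (\<Sum>q<k. x q) / N" by (simp add: cf_e sum_divide_distrib)
    finally show ?thesis by (simp add: cf_def)
  qed
  have cf_pos: "0 < cf x pq" if x: "x \<in> open_cube k" and pq: "pq \<in> I \<times> I" for x pq
  proof (cases "pq = (i0, i0)")
    case True
    have "(\<Sum>q<k. x q) \<le> (\<Sum>q<k. 1)"
      using x by (intro sum_mono) (auto simp: open_cube_def intro: less_imp_le)
    then show ?thesis using True by (simp add: cf_def N_def)
  next
    case False
    then obtain q where "q < k" "pq = e q"
      using pq e by (auto simp: bij_betw_def)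
    then show ?thesis using x by (simp add: cf_e N_def open_cube_def)
  qed
  define F where "F x = weighted_ketbras (I \<times> I) (\<lambda>pq. cf x pq / \<tau> pq) w" for x
  define f where "f x = real_coords (F x)" for x
  have cs: "w pq \<in> coord_space I" if "pq \<in> I \<times> I" for pq
    using product_vector_coord_space[OF pv[OF that]] by (simp add: I_def)
  have F_herm: "F x \<in> hermitian_operators I" for x
    unfolding F_def using cs by (rule weighted_ketbras_hermitian)
  have F_trace: "op_trace I (F x) = 1" for x
  proof -
    have "(\<Sum>pq\<in>I \<times> I. cf x pq / \<tau> pq * (\<Sum>a\<in>I. (cmod (w pq a))\<^sup>2)) = (\<Sum>pq\<in>I \<times> I. cf x pq)"
      unfolding \<tau>_def[symmetric] using \<tau> by (intro sum.cong refl) (simp add: less_imp_neq[symmetric])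
    then show ?thesis
      by (simp only: F_def op_trace_weighted_ketbras cf_sum of_real_1)
  qed
  have F_sep: "F x \<in> sep_states n d" if "x \<in> open_cube k" for x
    using F_trace[of x] unfolding F_def I_def
    by (intro weighted_ketbras_sep_state)
      (use \<open>0 < n\<close> pv cf_pos[OF that] \<tau> in \<open>auto simp: I_def finite_multi_indices\<close>)
  have poly: "(\<lambda>x. f x j) \<in> poly_functions {..<k}" for j
  proof -
    obtain a b c where j: "j = (a, b, c)" by (cases j)
    have "(\<lambda>x. cf x pq) \<in> poly_functions {..<k}" if "pq \<in> I \<times> I" for pq
    proof (cases "pq = (i0, i0)")
      case True
      have "(\<lambda>x. 1 - (\<Sum>q<k. x q) * (1 / N)) \<in> poly_functions {..<k}"
        by (intro poly_functions_diff poly_functions.mult poly_functions.const poly_functions_sum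
            poly_functions.coord)
      then show ?thesis using True by (simp add: cf_def)
    next
      case False
      then have "inv_into {..<k} e pq \<in> {..<k}"
        using that e by (intro inv_into_into) (auto simp: bij_betw_def)
      then have "(\<lambda>x. x (inv_into {..<k} e pq) * (1 / N)) \<in> poly_functions {..<k}"
        by (intro poly_functions.mult poly_functions.const poly_functions.coord)
      then show ?thesis using False by (simp add: cf_def)
    qed
    then have "complex_poly {..<k} (\<lambda>x. F x a b)"
      unfolding F_def weighted_ketbras_def divide_inverse
      by (intro complex_poly_sum complex_poly_mult complex_poly_of_real complex_poly_const
          poly_functions.mult poly_functions.const)
    then show ?thesis
      by (cases c) (simp_all add: f_def real_coords_def j complex_poly_def)
  qed
  \<comment> \<open>The real part of the pairing with the dual basis, written in real coordinates.
    It is linear, hence continuous; \<open>N * \<tau> (e q)\<close> undoes the scaling of the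
    weight.\<close>
  define g where "g y q = (if q < k then N * \<tau> (e q) * (\<Sum>a\<in>I. \<Sum>b\<in>I.
      Re (product_dual n d (e q) a b) * y (a, b, False) - Im (product_dual n d (e q) a b) * y (a, b, True)) else 0)"
    for y :: "(nat \<Rightarrow> nat) \<times> (nat \<Rightarrow> nat) \<times> bool \<Rightarrow> real" and q
  have gf: "g (f x) = x" if x: "x \<in> open_cube k" for x
  proof
    fix q
    show "g (f x) q = x q"
    proof (cases "q < k")
      case True
      let ?D = "product_dual n d (e q)"
      have "(\<Sum>a\<in>I. \<Sum>b\<in>I. ?D a b * F x a b) =
          (\<Sum>a\<in>I. \<Sum>b\<in>I. \<Sum>pq\<in>I \<times> I. of_real (cf x pq / \<tau> pq) * (?D a b * ketbra (w pq) a b))"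
        by (simp add: F_def weighted_ketbras_def sum_distrib_left mult_ac)
      also have "\<dots> = (\<Sum>a\<in>I. \<Sum>pq\<in>I \<times> I. \<Sum>b\<in>I. of_real (cf x pq / \<tau> pq) * (?D a b * ketbra (w pq) a b))"
        by (intro sum.cong refl sum.swap)
      also have "\<dots> = (\<Sum>pq\<in>I \<times> I. \<Sum>a\<in>I. \<Sum>b\<in>I. of_real (cf x pq / \<tau> pq) * (?D a b * ketbra (w pq) a b))"
        by (rule sum.swap)
      also have "\<dots> = (\<Sum>pq\<in>I \<times> I. of_real (cf x pq / \<tau> pq) * (\<Sum>a\<in>I. \<Sum>b\<in>I. ?D a b * ketbra (w pq) a b))"
        by (simp only: sum_distrib_left)
      also have "\<dots> = (\<Sum>pq\<in>I \<times> I. of_real (cf x pq / \<tau> pq) * (if e q = pq then 1 else 0))"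
        using e_in[OF True] unfolding w_def I_def
        by (intro sum.cong refl arg_cong2[where f = "(*)"] product_dual_ketbra) auto
      also have "\<dots> = (\<Sum>pq\<in>I \<times> I. if e q = pq then of_real (cf x pq / \<tau> pq) else 0)"
        by (intro sum.cong) auto
      also have "\<dots> = of_real (cf x (e q) / \<tau> (e q))"
        using fin e_in[OF True] by simp
      finally have "Re (\<Sum>a\<in>I. \<Sum>b\<in>I. ?D a b * F x a b) = cf x (e q) / \<tau> (e q)"
        by simp
      then have "g (f x) q = N * \<tau> (e q) * (cf x (e q) / \<tau> (e q))"
        using True by (simp add: g_def f_def real_coords_def)
      also have "\<dots> = x q"
        using \<tau>[OF e_in(1)[OF True]] True by (simp add: cf_e N_def)
      finally show ?thesis .
    next
      case False
      then show ?thesis using x by (simp add: g_def open_cube_def real_space_def)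
    qed
  qed
  have "homeomorphism (open_cube k) (f ` open_cube k) f g"
  proof (rule homeomorphismI)
    show "continuous_on (open_cube k) f"
      by (intro continuous_on_coordinatewise_then_product poly_functions_continuous[OF poly])
    show "continuous_on (f ` open_cube k) g"
    proof (rule continuous_on_coordinatewise_then_product)
      fix q
      have "continuous_on UNIV (\<lambda>y. g y q)"
        unfolding g_def by (cases "q < k") (auto intro!: continuous_intros)
      then show "continuous_on (f ` open_cube k) (\<lambda>y. g y q)"
        by (rule continuous_on_subset) simp
    qed
  qed (use gf in auto)
  moreover have "f x j = 0" if "j \<notin> I \<times> I \<times> UNIV" for x j
    using that hermitian_outside[OF F_herm[of x]]
    by (cases j) (auto simp: f_def real_coords_def)
  ultimately have "semialgebraic_cell (I \<times> I \<times> UNIV) k (f ` open_cube k)"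
    using poly fin by (intro semialgebraic_cell_poly) auto
  moreover have "f ` open_cube k \<subseteq> real_coords ` sep_states n d"
    using F_sep by (auto simp: f_def)
  ultimately show ?thesis by blast
qed

section \<open>The inequalities\<close>

lemma real_coords_in_real_space:
  assumes "A \<in> hyperplane I"
  shows "real_coords A \<in> real_space (I \<times> I \<times> UNIV)"
proof -
  have "A \<in> hermitian_operators I"
    using assms by (simp add: hyperplane_def)
  then show ?thesis
    by (auto simp: real_space_def real_coords_def hermitian_outside)
qed

lemma hyperplane_coords_exist:
  assumes "finite I" "I \<noteq> {}"
  obtains i0 k e where "hyperplane_coords I i0 k e"
proof -
  obtain i0 where i0: "i0 \<in> I" using assms by blast
  have "finite (I \<times> I - {(i0, i0)})" using assms by simp
  from ex_bij_betw_nat_finite[OF this] obtain e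
    where "bij_betw e {..<card (I \<times> I - {(i0, i0)})} (I \<times> I - {(i0, i0)})"
    by (auto simp: atLeast0LessThan)
  then show thesis
    using that assms i0 by (simp add: hyperplane_coords_def)
qed

lemma total_dim_squared_le_if_full_dim:
  assumes d: "\<And>i. i < n \<Longrightarrow> 0 < d i"
    and coords: "hyperplane_coords (multi_indices n d) i0 k e"
    and dim: "operator_set_dim (multi_indices n d) (sep_states_le n d r) = int k"
  shows "(total_dim n d)\<^sup>2 \<le> r * product_params n d"
proof -
  define I where "I = multi_indices n d"
  interpret hyperplane_coords I i0 k e using coords by (simp add: I_def)
  have sub: "sep_states_le n d r \<subseteq> hyperplane I"
    by (auto simp: sep_states_le_def sep_states_def trace_one_hyperplane_eq I_def)
  have "\<exists>C\<subseteq>real_coords ` sep_states_le n d r. semialgebraic_cell (I \<times> I \<times> UNIV) k C"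
    using sub dim fin real_coords_in_real_space[of _ I]
    by (intro semialgebraic_dim_eqD) (auto simp: operator_set_dim_def I_def)
  then obtain C where C: "C \<subseteq> real_coords ` sep_states_le n d r" "semialgebraic_cell (I \<times> I \<times> UNIV) k C"
    by blast
  show ?thesis
  proof (rule cone_contains_box[OF C(2,1) sub])
    fix a \<epsilon>
    assume \<epsilon>: "0 < \<epsilon>"
      and box: "\<And>x. \<forall>ij\<in>I \<times> I. a ij \<le> x ij \<and> x ij \<le> a ij + \<epsilon> \<Longrightarrow>
        \<exists>\<rho>\<in>sep_states_le n d r. \<exists>s. 0 < s \<and> s \<le> 1 \<and> (\<forall>ij\<in>I \<times> I. x ij = s * herm_coord \<rho> ij)"
    have "card (I \<times> I) \<le> card (sep_params n d r)"
    proof (rule poly_image_covers_box_imp_card_le[of _ _ "sep_charts n d r"])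
      show "(\<lambda>t. herm_coord (chart_operator n r c t) ij) \<in> poly_functions (sep_params n d r)"
        if "c \<in> sep_charts n d r" "ij \<in> I \<times> I" for c ij
        using that chart_operator_poly[of c n d r] by (auto simp: I_def)
      fix x assume "\<forall>ij\<in>I \<times> I. a ij \<le> x ij \<and> x ij \<le> a ij + \<epsilon>"
      from box[OF this] obtain \<rho> s where \<rho>: "\<rho> \<in> sep_states_le n d r" and s: "0 < s" "s \<le> 1"
        and x: "\<forall>ij\<in>I \<times> I. x ij = s * herm_coord \<rho> ij"
        by blast
      from cone_over_sep_states_le_in_charts[OF d \<rho> s]
      show "\<exists>c\<in>sep_charts n d r. \<exists>t. (\<forall>p\<in>sep_params n d r. \<bar>t p\<bar> \<le> 1) \<and>
          (\<forall>ij\<in>I \<times> I. x ij = herm_coord (chart_operator n r c t) ij)"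
        using x unfolding I_def by simp
    qed (use fin \<epsilon> in \<open>auto simp: finite_sep_params finite_sep_charts\<close>)
    then show ?thesis
      by (simp add: card_cartesian_product I_def card_multi_indices power2_eq_square card_sep_params)
  qed
qed

theorem proposition6:
  fixes n :: nat and d :: "nat \<Rightarrow> nat"
  assumes "n > 1"
    and "\<And>i. i < n \<Longrightarrow> d i > 1"
  shows "total_dim n d \<le> L_c n d \<and> L_c n d \<le> L_crit n d \<and>
    L_crit n d \<le> L_max n d \<and> L_max n d \<le> (total_dim n d)\<^sup>2"
proof -
  define I where "I = multi_indices n d"
  have d: "0 < d i" if "i < n" for i
    using assms(2)[OF that] by simp
  have n: "0 < n"
    using assms(1) by simp
  have "0 < total_dim n d"
    unfolding total_dim_def using d by (intro prod_pos) simp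
  then have "I \<noteq> {}"
    using card_multi_indices[of n d] by (auto simp: I_def)
  then obtain i0 k e where coords: "hyperplane_coords I i0 k e"
    using hyperplane_coords_exist[of I] by (auto simp: I_def finite_multi_indices)
  interpret hyperplane_coords I i0 k e by (rule coords)
  have "(total_dim n d)\<^sup>2 = Suc k"
    using card_eq by (simp add: I_def card_multi_indices)
  then have k: "int ((total_dim n d)\<^sup>2) - 1 = int k"
    by simp
  define full where "full r \<longleftrightarrow> 0 < r \<and> operator_set_dim (multi_indices n d) (sep_states_le n d r) = int ((total_dim n d)\<^sup>2) - 1" for r
  define all where "all r \<longleftrightarrow> 0 < r \<and> sep_states_le n d r = sep_states n d" for r
  \<comment> \<open>A witness serves twice: it shows that the minimum defining \<open>L_max\<close>
    is attained and bounds it from above.\<close>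
  have "all ((total_dim n d)\<^sup>2)"
    using \<open>0 < total_dim n d\<close> sep_states_le_total_dim_squared[OF n, of d] by (simp add: all_def)
  then have max: "all (L_max n d)" "L_max n d \<le> (total_dim n d)\<^sup>2"
    unfolding L_max_def all_def[symmetric] by (rule LeastI, rule Least_le)
  \<comment> \<open>At \<open>L_max\<close> all separable states are present, so the simplex gives
    full dimension. This shows that \<open>L_crit\<close> is attained and bounds it.\<close>
  have "full (L_max n d)"
  proof -
    obtain C where "C \<subseteq> real_coords ` sep_states n d" "semialgebraic_cell (I \<times> I \<times> UNIV) k C"
      using sep_states_full_cell[OF n coords[unfolded I_def]] by (auto simp: I_def)
    moreover have "sep_states n d \<subseteq> hyperplane I"
      by (auto simp: sep_states_def trace_one_hyperplane_eq I_def)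
    ultimately have "operator_set_dim I (sep_states n d) = int k"
      unfolding operator_set_dim_def by (intro semialgebraic_dim_eqI) auto
    then show ?thesis using max(1) unfolding full_def all_def k I_def by simp
  qed
  then have crit: "full (L_crit n d)" "L_crit n d \<le> L_max n d"
    unfolding L_crit_def full_def[symmetric] by (rule LeastI, rule Least_le)
  have "(total_dim n d)\<^sup>2 \<le> L_crit n d * product_params n d"
    using crit(1) coords unfolding full_def k I_def
    by (intro total_dim_squared_le_if_full_dim[OF d]) simp_all
  then have "L_c n d \<le> L_crit n d"
    using assms(2) by (intro L_c_le) auto
  with total_dim_le_L_c[of n d, OF assms] crit(2) max(2) show ?thesis by blast
qed

end
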